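(* Let $S$ be a smooth phase function on a neighborhood of the origin in $\mathbb{R}^2$ in superadapted coordinates with Newton distance $d=d(S)>1$. Let $\phi\in C_c^\infty(\mathbb{R}^2)$ be supported in a sufficiently small neighborhood of the origin and nonnegative, with $\phi(0,0)>0$. In Case 1, $$\limsup_{\lambda\to\infty}\left|\frac{J_{S,\phi}(\lambda)}{\lambda^{-1/d}}\right|>0.$$ In Case 2, $$\limsup_{\lambda\to\infty}\left|\frac{J_{S,\phi}(\lambda)}{\lambda^{-1/d}\ln(\lambda)}\right|>0.$$ In Case 3, for every $\delta>0$, $$\limsup_{\lambda\to\infty}\left|\frac{J_{S,\phi}(\lambda)}{\lambda^{-\frac1d-\delta}}\right|=\infty.$$
   Context: Standing assumptions: $S$ is real-valued, $S(0,0)=0$, $\nabla S(0,0)=0$, and the Taylor expansion $\sum_{a,b}s_{ab}x^ay^b$ of $S$ at the origin is not identically zero. Newton polygon: $N(S)$ is the convex hull of the union of the quadrants $\{(t_1,t_2): t_1\ge a,\ t_2\ge b\}$ over all $(a,b)$ with $s_{ab}\neq0$. Its boundary consists of finitely many (possibly zero) compact edges of negative slope together with an unbounded vertical ray and an unbounded horizontal ray. The Newton distance is $d(S)=\inf\{t:(t,t)\in N(S)\}$, and the bisectrix is the line $t_1=t_2$. "The bisectrix intersects $N(S)$" at/in a part of $N(S)$ means that the boundary point $(d(S),d(S))$ lies there. For a compact edge $e$ of $N(S)$ put $S_e(x,y)=\sum_{(a,b)\in e}s_{ab}x^ay^b$. $S$ is in superadapted coordinates if for every compact edge $e$ of $N(S)$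 intersecting the bisectrix, neither $S_e(1,y)$ nor $S_e(-1,y)$ has a real zero of order $\ge d(S)$ other than possibly $y=0$. Case 1: the bisectrix intersects $N(S)$ in the interior of a compact edge. Case 2: it intersects $N(S)$ at a vertex $(d,d)$. Case 3: it intersects $N(S)$ in the interior of one of the unbounded rays. $J_{S,\phi}(\lambda)=\int_{\mathbb{R}^2}e^{i\lambda S(x,y)}\phi(x,y)\,dx\,dy$. *)

theory Defs
  imports "HOL-Analysis.Analysis" "HOL-Computational_Algebra.Polynomial"
begin

text \<open>A point of the plane is a pair. Smoothness is only required on an open set;
  the values of a function outside this set are irrelevant.\<close>

primrec Ck_on :: "nat \<Rightarrow> (real \<times> real \<Rightarrow> real) \<Rightarrow> (real \<times> real) set \<Rightarrow> bool" where
  "Ck_on 0 f U \<longleftrightarrow> continuous_on U f"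
| "Ck_on (Suc n) f U \<longleftrightarrow>
     (\<forall>p\<in>U. f differentiable (at p)) \<and> (\<forall>v. Ck_on n (\<lambda>p. frechet_derivative f (at p) v) U)"

definition smooth_on :: "(real \<times> real \<Rightarrow> real) \<Rightarrow> (real \<times> real) set \<Rightarrow> bool" where
  "smooth_on f U \<longleftrightarrow> open U \<and> (\<forall>n. Ck_on n f U)"

definition dir_deriv :: "real \<times> real \<Rightarrow> (real \<times> real \<Rightarrow> real) \<Rightarrow> real \<times> real \<Rightarrow> real" where
  "dir_deriv v f p = frechet_derivative f (at p) v"

definition taylor_coeff :: "(real \<times> real \<Rightarrow> real) \<Rightarrow> nat \<Rightarrow> nat \<Rightarrow> real" where
  "taylor_coeff S a b =
     (dir_deriv (1, 0) ^^ a) ((dir_deriv (0, 1) ^^ b) S) (0, 0) / (fact a * fact b)"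

definition newton_polygon :: "(real \<times> real \<Rightarrow> real) \<Rightarrow> (real \<times> real) set" where
  "newton_polygon S = convex hull
     (\<Union>(a, b) \<in> {(a, b). taylor_coeff S a b \<noteq> 0}. {(t1, t2). t1 \<ge> real a \<and> t2 \<ge> real b})"

definition newton_distance :: "(real \<times> real \<Rightarrow> real) \<Rightarrow> real" where
  "newton_distance S = Inf {t. (t, t) \<in> newton_polygon S}"

abbreviation bisectrix_point :: "(real \<times> real \<Rightarrow> real) \<Rightarrow> real \<times> real" where
  "bisectrix_point S \<equiv> (newton_distance S, newton_distance S)"

text \<open>The sums below are finite for compact \<open>e\<close>, the only edges they are used for.\<close>

definition edge_part :: "(real \<times> real \<Rightarrow> real) \<Rightarrow> (real \<times> real) set \<Rightarrow> real \<Rightarrow> real \<Rightarrow> real" where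
  "edge_part S e x y =
     (\<Sum>(a, b) \<in> {(a, b). (real a, real b) \<in> e}. taylor_coeff S a b * x ^ a * y ^ b)"

text \<open>The one-variable function \<open>y \<mapsto> edge_part S e x y\<close> as a polynomial in \<open>y\<close>, so that
  the multiplicity of a zero is given by \<^const>\<open>order\<close>.\<close>

definition edge_poly :: "(real \<times> real \<Rightarrow> real) \<Rightarrow> (real \<times> real) set \<Rightarrow> real \<Rightarrow> real poly" where
  "edge_poly S e x =
     (\<Sum>(a, b) \<in> {(a, b). (real a, real b) \<in> e}. monom (taylor_coeff S a b * x ^ a) b)"

lemma poly_edge_poly: "poly (edge_poly S e x) y = edge_part S e x y"
  by (simp add: edge_poly_def edge_part_def poly_sum poly_monom case_prod_unfold)

definition superadapted :: "(real \<times> real \<Rightarrow> real) \<Rightarrow> bool" where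
  "superadapted S \<longleftrightarrow>
     (\<forall>e. e edge_of newton_polygon S \<and> compact e \<and> bisectrix_point S \<in> e \<longrightarrow>
       (\<forall>x\<in>{1, -1}. \<not> (\<exists>y. y \<noteq> 0 \<and> edge_part S e x y = 0 \<and>
           real (order y (edge_poly S e x)) \<ge> newton_distance S)))"

definition bisectrix_in_compact_edge :: "(real \<times> real \<Rightarrow> real) \<Rightarrow> bool" where
  "bisectrix_in_compact_edge S \<longleftrightarrow>
     (\<exists>e. e edge_of newton_polygon S \<and> compact e \<and> bisectrix_point S \<in> rel_interior e)"

definition bisectrix_at_vertex :: "(real \<times> real \<Rightarrow> real) \<Rightarrow> bool" where
  "bisectrix_at_vertex S \<longleftrightarrow> bisectrix_point S extreme_point_of newton_polygon S"

definition bisectrix_in_unbounded_ray :: "(real \<times> real \<Rightarrow> real) \<Rightarrow> bool" where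
  "bisectrix_in_unbounded_ray S \<longleftrightarrow>
     (\<exists>e. e edge_of newton_polygon S \<and> \<not> bounded e \<and> bisectrix_point S \<in> rel_interior e)"

definition osc_integral ::
  "(real \<times> real \<Rightarrow> real) \<Rightarrow> (real \<times> real \<Rightarrow> real) \<Rightarrow> real \<Rightarrow> complex" where
  "osc_integral S \<phi> lam =
     (LINT p|lborel. exp (\<i> * complex_of_real (lam * S p)) * complex_of_real (\<phi> p))"

end

theory Submission
  imports Defs
begin

text \<open>Let \<open>\<mu>\<close> be the image under \<open>S\<close> of the measure \<open>\<phi> dx dy\<close>, so that \<open>J\<close> is its Fourier transform.
  Testing \<open>\<mu>\<close> against a Fejer kernel gives \<open>\<mu> {\<bar>s\<bar> \<le> 1/T} \<le> 4/T \<integral>\<^sub>0\<^sup>T \<bar>J\<bar>\<close>. As \<open>d > 1\<close>, the exponent \<open>1/d\<close> is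
  integrable at the origin, and decay of \<open>J\<close> faster than claimed would make the sublevel sets
  \<open>{\<bar>S\<bar> \<le> \<epsilon>}\<close> too small. They are not: if \<open>k a + l b \<ge> 1\<close> for all \<open>(a, b)\<close> in the Taylor support, then
  \<open>S = O(\<epsilon>)\<close> on the box \<open>\<bar>x\<bar> \<le> \<epsilon>\<^sup>k, \<bar>y\<bar> \<le> \<epsilon>\<^sup>l\<close>, of measure \<open>4 \<epsilon>\<^bsup>k+l\<^esup>\<close>. A supporting line of the Newton
  polygon at \<open>(d, d)\<close> provides weights with \<open>k + l = 1/d\<close>. In the interior of a compact edge both are
  positive; at a vertex a whole interval of weights is admissible, and the union of the boxes gains
  the factor \<open>ln (1/\<epsilon>)\<close>; on a ray one weight may vanish, and increasing both slightly costs \<open>\<delta>\<close>.\<close>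

subsection \<open>Fourier decay bounds sublevel sets\<close>

text \<open>Cosine transform of half of the symmetric triangle weight. As \<phi> and the phase are
  real, J(-t) is the conjugate of J(t), so real parts over t \<ge> 0 carry the same information as
  the full transform.\<close>

definition fejer_kernel :: "real \<Rightarrow> real \<Rightarrow> real" where
  "fejer_kernel T s = (LINT t|lborel. (1 - t / T) * cos (t * s) * indicator {0..T} t)"

lemma fejer_kernel_eq:
  assumes "T > 0" "s \<noteq> 0"
  shows "fejer_kernel T s = (1 - cos (T * s)) / (T * s\<^sup>2)"
proof -
  \<comment> \<open>This antiderivative in t comes from one integration by parts.\<close>
  let ?F = "\<lambda>t. (1 - t / T) * sin (t * s) / s - cos (t * s) / (T * s\<^sup>2)"
  have "fejer_kernel T s = ?F T - ?F 0"
    unfolding fejer_kernel_def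
  proof (rule integral_FTC_Icc_real)
    fix t
    show "(?F has_real_derivative (1 - t / T) * cos (t * s)) (at t)"
      using assms by (auto intro!: derivative_eq_intros simp: field_simps power2_eq_square)
    show "isCont (\<lambda>t. (1 - t / T) * cos (t * s)) t"
      using assms by (intro continuous_intros) auto
  qed (use assms in auto)
  also have "\<dots> = (1 - cos (T * s)) / (T * s\<^sup>2)"
    using assms by (simp add: field_simps)
  finally show ?thesis .
qed

text \<open>For t in [0, T] the phase satisfies |t s| \<le> 1 \<le> pi/3, so the cosine is at least
  1/2, and half of the triangle weight has integral T/4.\<close>

lemma fejer_kernel_ge:
  assumes "T > 0" "\<bar>s\<bar> \<le> 1 / T"
  shows "T / 4 \<le> fejer_kernel T s"
proof -
  have bnd: "has_bochner_integral lborel (\<lambda>t. ((1 - t / T) / 2) * indicator {0..T} t)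
      ((\<lambda>t. t / 2 - t\<^sup>2 / (4 * T)) T - (\<lambda>t. t / 2 - t\<^sup>2 / (4 * T)) 0)"
  proof (rule has_bochner_integral_FTC_Icc_real)
    fix t
    show "((\<lambda>t. t / 2 - t\<^sup>2 / (4 * T)) has_real_derivative (1 - t / T) / 2) (at t)"
      using assms by (auto intro!: derivative_eq_intros simp: field_simps)
    show "isCont (\<lambda>t. (1 - t / T) / 2) t"
      using assms by (intro continuous_intros) auto
  qed (use assms in auto)
  have int: "integrable lborel (\<lambda>t. (1 - t / T) * cos (t * s) * indicator {0..T} t)"
  proof -
    have "continuous_on {0..T} (\<lambda>t. (1 - t / T) * cos (t * s))"
      using assms by (intro continuous_intros) auto
    from borel_integrable_compact[OF _ this] show ?thesis by (simp add: mult.commute)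
  qed
  have "(1 - t / T) / 2 * indicator {0..T} t \<le> (1 - t / T) * cos (t * s) * indicator {0..T} t" for t
  proof (cases "t \<in> {0..T}")
    case True
    have "\<bar>t * s\<bar> \<le> T * (1 / T)"
      unfolding abs_mult using True assms by (intro mult_mono) auto
    then have "\<bar>t * s\<bar> \<le> pi / 3" using assms pi_gt3 by simp
    then have "cos (pi / 3) \<le> cos \<bar>t * s\<bar>" by (intro cos_monotone_0_pi_le) auto
    then have "1 / 2 \<le> cos (t * s)" by (simp add: cos_60)
    then have "(1 - t / T) * (1 / 2) \<le> (1 - t / T) * cos (t * s)"
      using True assms by (intro mult_left_mono) auto
    then show ?thesis using True by simp
  qed auto
  then have "(LINT t|lborel. (1 - t / T) / 2 * indicator {0..T} t) \<le> fejer_kernel T s"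
    unfolding fejer_kernel_def using bnd int by (intro integral_mono) (auto simp: has_bochner_integral_iff)
  then show ?thesis
    using has_bochner_integral_integral_eq[OF bnd] assms by (simp add: power2_eq_square)
qed

text \<open>Away from zero the closed form shows the sign, since 1 - cos \<ge> 0; at s = 0, where
  that form degenerates, the lower bound T/4 takes over.\<close>

lemma fejer_kernel_nonneg:
  assumes "T > 0"
  shows "0 \<le> fejer_kernel T s"
  using fejer_kernel_eq[OF assms, of s] fejer_kernel_ge[OF assms, of s] assms
  by (cases "s = 0") auto

lemma has_bochner_integral_powr_from_0:
  fixes a c :: real
  assumes "a > -1" "c \<ge> 0"
  shows "has_bochner_integral lborel (\<lambda>x. x powr a * indicator {0..c} x) (c powr (a + 1) / (a + 1))"
proof (rule has_bochner_integral_nn_integral)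
  have "(\<integral>\<^sup>+x. ennreal (x powr a * indicator {0..c} x) \<partial>lborel)
      = (\<integral>\<^sup>+x. ennreal (x powr a) * indicator {0..c} x \<partial>lborel)"
    by (intro nn_integral_cong) (auto split: split_indicator)
  also have "\<dots> = ennreal (c powr (a + 1) / (a + 1))"
    by (rule nn_integral_has_integral_lebesgue'[OF _ has_integral_powr_from_0[OF assms]]) auto
  finally show "(\<integral>\<^sup>+x. ennreal (x powr a * indicator {0..c} x) \<partial>lborel)
      = ennreal (c powr (a + 1) / (a + 1))" .
qed (use assms in auto)

text \<open>Integrating the Fourier transform of the image measure against the triangle weight
  \<open>1 - t / T\<close> gives the integral of a Fejer kernel, which is nonnegative everywhere and of size \<open>T\<close>
  on \<open>[-1/T, 1/T]\<close>.\<close>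

lemma sublevel_measure_le_fourier:
  fixes f \<phi> :: "'a::euclidean_space \<Rightarrow> real"
  assumes f[measurable]: "f \<in> borel_measurable borel" and \<phi>: "integrable lborel \<phi>" "\<And>p. 0 \<le> \<phi> p"
    and A: "A \<in> sets lborel" "emeasure lborel A < \<infinity>" and c: "0 \<le> c" "\<And>p. p \<in> A \<Longrightarrow> c \<le> \<phi> p"
    and small: "\<And>p. p \<in> A \<Longrightarrow> \<bar>f p\<bar> \<le> 1 / T"
    and T: "0 < \<Lambda>" "\<Lambda> \<le> T" and "\<alpha> < 1" and "0 \<le> B"
    and decay: "\<And>t. \<Lambda> \<le> t \<Longrightarrow> t \<le> T \<Longrightarrow>
      cmod (LINT p|lborel. exp (\<i> * complex_of_real (t * f p)) * complex_of_real (\<phi> p)) \<le> B * t powr (- \<alpha>)"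
  shows "T / 4 * (c * measure lborel A) \<le> \<Lambda> * (LINT p|lborel. \<phi> p) + B * T powr (1 - \<alpha>) / (1 - \<alpha>)"
proof -
  have \<phi>m[measurable]: "\<phi> \<in> borel_measurable borel" using borel_measurable_integrable[OF \<phi>(1)] by simp
  have "T > 0" using T by simp
  define I where "I = (LINT p|lborel. \<phi> p)"
  have I: "I \<ge> 0" unfolding I_def using \<phi> by (intro integral_nonneg_AE) auto
  define w where "w t = (1 - t / T) * indicator {0..T} t" for t :: real
  have [measurable]: "w \<in> borel_measurable borel" unfolding w_def by measurable
  have w: "0 \<le> w t" "w t \<le> indicator {0..T} t" "w t \<le> 1" for t
    using \<open>T > 0\<close> by (auto simp: w_def indicator_def)
  \<comment> \<open>Integrating \<open>F\<close> in t yields the Fejer kernel at \<open>f p\<close>,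
    and integrating it in p yields the real part of J. Fubini equates the two iterated integrals,
    with the product of \<phi> and the indicator of [0, T] as integrable majorant.\<close>
  define F where "F p t = w t * cos (t * f p) * \<phi> p" for p t
  have F_bound: "norm (F p t) \<le> norm (indicator {0..T} t * \<phi> p)" for p t
  proof -
    have "\<bar>w t * cos (t * f p)\<bar> \<le> indicator {0..T} t * 1"
      unfolding abs_mult using w[of t] by (intro mult_mono) auto
    then show ?thesis using \<phi>(2)[of p] unfolding F_def by (simp add: abs_mult mult_right_mono)
  qed
  interpret P: pair_sigma_finite "lborel :: 'a measure" "lborel :: real measure" ..
  have ind: "integrable lborel (indicator {0..T} :: real \<Rightarrow> real)"
    using \<open>T > 0\<close> by (intro integrable_real_indicator) (auto simp: emeasure_lborel_Icc)
  have dom: "integrable (lborel \<Otimes>\<^sub>M lborel) (\<lambda>z. indicator {0..T} (snd z) * \<phi> (fst z))"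
  proof (rule lborel_pair.Fubini_integrable)
    show "(\<lambda>z. indicator {0..T} (snd z) * \<phi> (fst z)) \<in> borel_measurable (lborel \<Otimes>\<^sub>M lborel)" by measurable
    show "integrable lborel (\<lambda>x. LINT y|lborel. norm (indicator {0..T} (snd (x, y)) * \<phi> (fst (x, y))))"
      using \<phi> by (simp add: abs_mult)
    show "AE x in lborel. integrable lborel (\<lambda>y. indicator {0..T} (snd (x, y)) * \<phi> (fst (x, y)))"
      using ind by simp
  qed
  have F_int: "integrable (lborel \<Otimes>\<^sub>M lborel) (case_prod F)"
  proof (rule Bochner_Integration.integrable_bound[OF dom])
    show "case_prod F \<in> borel_measurable (lborel \<Otimes>\<^sub>M lborel)" unfolding F_def by measurable
    show "AE z in lborel \<Otimes>\<^sub>M lborel. norm (case_prod F z) \<le> norm (indicator {0..T} (snd z) * \<phi> (fst z))"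
      using F_bound by (auto simp: case_prod_unfold)
  qed
  have inner1: "(LINT t|lborel. F p t) = fejer_kernel T (f p) * \<phi> p" for p
  proof -
    have "F p t = ((1 - t / T) * cos (t * f p) * indicator {0..T} t) * \<phi> p" for t
      by (simp add: F_def w_def)
    then show ?thesis by (simp add: fejer_kernel_def)
  qed
  define J where "J t = (LINT p|lborel. exp (\<i> * complex_of_real (t * f p)) * complex_of_real (\<phi> p))" for t
  have E_int: "integrable lborel (\<lambda>p. exp (\<i> * complex_of_real (t * f p)) * complex_of_real (\<phi> p))" for t
  proof (rule Bochner_Integration.integrable_bound[OF \<phi>(1)])
    show "(\<lambda>p. exp (\<i> * complex_of_real (t * f p)) * complex_of_real (\<phi> p)) \<in> borel_measurable lborel" by measurable
  qed (simp add: norm_mult)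
  have inner2: "(LINT p|lborel. F p t) = w t * Re (J t)" for t
  proof -
    have "Re (J t) = (LINT p|lborel. Re (exp (\<i> * complex_of_real (t * f p)) * complex_of_real (\<phi> p)))"
      unfolding J_def using E_int by (rule integral_Re[symmetric])
    also have "\<dots> = (LINT p|lborel. cos (t * f p) * \<phi> p)" by (simp add: Re_exp)
    finally show ?thesis by (simp add: F_def mult.assoc)
  qed
  have J_le: "cmod (J t) \<le> I" for t
  proof -
    have "cmod (J t) \<le> (LINT p|lborel. cmod (exp (\<i> * complex_of_real (t * f p)) * complex_of_real (\<phi> p)))"
      unfolding J_def by (rule integral_norm_bound)
    also have "\<dots> = I" using \<phi>(2) by (simp add: norm_mult I_def)
    finally show ?thesis .
  qed
  have lower: "T / 4 * (c * measure lborel A) \<le> (LINT p|lborel. fejer_kernel T (f p) * \<phi> p)"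
  proof -
    have "T / 4 * (c * measure lborel A) = (LINT p|lborel. T / 4 * (c * indicator A p))"
      using A by simp
    also have "\<dots> \<le> (LINT p|lborel. fejer_kernel T (f p) * \<phi> p)"
    proof (rule integral_mono)
      show "integrable lborel (\<lambda>p. T / 4 * (c * indicator A p))" using A by simp
      show "integrable lborel (\<lambda>p. fejer_kernel T (f p) * \<phi> p)"
        using lborel_pair.integrable_fst[OF F_int] by (simp add: inner1)
      show "T / 4 * (c * indicator A p) \<le> fejer_kernel T (f p) * \<phi> p" for p
      proof (cases "p \<in> A")
        case True
        then have "T / 4 * c \<le> fejer_kernel T (f p) * \<phi> p"
          using fejer_kernel_ge[OF \<open>T > 0\<close> small] \<open>T > 0\<close> c
          by (intro mult_mono) (auto intro: fejer_kernel_nonneg)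
        then show ?thesis using True by simp
      qed (use fejer_kernel_nonneg[OF \<open>T > 0\<close>] \<phi> in auto)
    qed
    finally show ?thesis .
  qed
  have powr_int: "has_bochner_integral lborel (\<lambda>t. t powr (- \<alpha>) * indicator {0..T} t) (T powr (1 - \<alpha>) / (1 - \<alpha>))"
    using has_bochner_integral_powr_from_0[of "- \<alpha>" T] \<open>\<alpha> < 1\<close> \<open>T > 0\<close> by (simp add: add.commute)
  \<comment> \<open>The majorant of |J| on [0, T]: the trivial bound \<open>I\<close> below
    \<Lambda> and the decay hypothesis above it. The power of t is integrated from 0 on, which
    converges because \<alpha> < 1.\<close>
  have "has_bochner_integral lborel (indicator {0..\<Lambda>} :: real \<Rightarrow> real) (measure lborel {0..\<Lambda>})"
    using T by (intro has_bochner_integral_real_indicator) (auto simp: emeasure_lborel_Icc)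
  then have "has_bochner_integral lborel (\<lambda>t. I * indicator {0..\<Lambda>} t + B * (t powr (- \<alpha>) * indicator {0..T} t))
      (I * \<Lambda> + B * (T powr (1 - \<alpha>) / (1 - \<alpha>)))"
    using T powr_int by (intro has_bochner_integral_add has_bochner_integral_mult_right) auto
  then have maj: "integrable lborel (\<lambda>t. I * indicator {0..\<Lambda>} t + B * (t powr (- \<alpha>) * indicator {0..T} t))"
    "(LINT t|lborel. I * indicator {0..\<Lambda>} t + B * (t powr (- \<alpha>) * indicator {0..T} t))
      = I * \<Lambda> + B * (T powr (1 - \<alpha>) / (1 - \<alpha>))"
    by (auto simp: has_bochner_integral_iff)
  have "(LINT p|lborel. fejer_kernel T (f p) * \<phi> p) = (LINT t|lborel. w t * Re (J t))"
    using lborel_pair.Fubini_integral[OF F_int] by (simp add: inner1 inner2)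
  also have "\<dots> \<le> (LINT t|lborel. I * indicator {0..\<Lambda>} t + B * (t powr (- \<alpha>) * indicator {0..T} t))"
  proof (rule integral_mono)
    show "integrable lborel (\<lambda>t. w t * Re (J t))"
      using lborel_pair.integrable_snd[OF F_int] by (simp add: inner2)
    show "w t * Re (J t) \<le> I * indicator {0..\<Lambda>} t + B * (t powr (- \<alpha>) * indicator {0..T} t)" for t
    proof -
      have "w t * Re (J t) \<le> indicator {0..T} t * cmod (J t)"
        using w[of t] complex_Re_le_cmod[of "J t"]
        by (meson mult_left_mono mult_right_mono norm_ge_zero order_trans)
      also have "\<dots> \<le> I * indicator {0..\<Lambda>} t + B * (t powr (- \<alpha>) * indicator {0..T} t)"
        using J_le[of t] decay[of t] I \<open>0 \<le> B\<close> T unfolding J_def[symmetric]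
        by (auto simp: indicator_def intro: add_increasing2)
      finally show ?thesis .
    qed
  qed (fact maj)
  finally show ?thesis using lower maj(2) by (simp add: I_def mult.commute)
qed

subsection \<open>Taylor expansion on anisotropic boxes\<close>

lemma smooth_on_dir_deriv: "smooth_on f U \<Longrightarrow> smooth_on (dir_deriv v f) U"
  unfolding smooth_on_def dir_deriv_def by (metis Ck_on.simps(2))

lemma smooth_on_dir_deriv_iter: "smooth_on f U \<Longrightarrow> smooth_on ((dir_deriv v ^^ k) f) U"
  by (induction k) (auto intro: smooth_on_dir_deriv)

lemma smooth_on_continuous: "smooth_on f U \<Longrightarrow> continuous_on U f"
  unfolding smooth_on_def by (metis Ck_on.simps(1))

lemma smooth_on_DERIV_line:
  assumes "smooth_on f U" "p + t *\<^sub>R v \<in> U"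
  shows "((\<lambda>t. f (p + t *\<^sub>R v)) has_real_derivative dir_deriv v f (p + t *\<^sub>R v)) (at t)"
proof -
  have "f differentiable (at (p + t *\<^sub>R v))"
    using assms unfolding smooth_on_def by (metis Ck_on.simps(2))
  then have *: "(f has_derivative frechet_derivative f (at (p + t *\<^sub>R v))) (at (p + t *\<^sub>R v))"
    by (simp add: frechet_derivative_works)
  then have lin: "linear (frechet_derivative f (at (p + t *\<^sub>R v)))"
    by (rule has_derivative_linear)
  have "((\<lambda>t. f (p + t *\<^sub>R v)) has_derivative
      (\<lambda>h. frechet_derivative f (at (p + t *\<^sub>R v)) (h *\<^sub>R v))) (at t)"
    by (rule has_derivative_compose[of "\<lambda>t. p + t *\<^sub>R v" "\<lambda>h. h *\<^sub>R v", OF _ *])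
       (auto intro!: derivative_eq_intros)
  moreover have "(\<lambda>h. frechet_derivative f (at (p + t *\<^sub>R v)) (h *\<^sub>R v))
      = (*) (dir_deriv v f (p + t *\<^sub>R v))"
    by (auto simp: dir_deriv_def linear_cmul[OF lin])
  ultimately show ?thesis by (simp add: has_field_derivative_def)
qed

text \<open>The derivatives of t \<mapsto> f (p + t v) are the iterated directional derivatives
  along the line, so the one-variable Maclaurin formula with Lagrange remainder applies.\<close>

lemma smooth_on_taylor_line:
  assumes "smooth_on f U" and seg: "\<And>t. \<bar>t\<bar> \<le> \<bar>s\<bar> \<Longrightarrow> p + t *\<^sub>R v \<in> U"
  shows "\<exists>t. \<bar>t\<bar> \<le> \<bar>s\<bar> \<and> f (p + s *\<^sub>R v)
     = (\<Sum>m<n. (dir_deriv v ^^ m) f p / fact m * s ^ m)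
       + (dir_deriv v ^^ n) f (p + t *\<^sub>R v) / fact n * s ^ n"
proof -
  have "\<exists>t. \<bar>t\<bar> \<le> \<bar>s\<bar> \<and> f (p + s *\<^sub>R v)
     = (\<Sum>m<n. (\<lambda>t. (dir_deriv v ^^ m) f (p + t *\<^sub>R v)) 0 / fact m * s ^ m)
       + (\<lambda>t. (dir_deriv v ^^ n) f (p + t *\<^sub>R v)) t / fact n * s ^ n"
  proof (rule Maclaurin_bi_le, simp, safe)
    fix m t assume "m < n" "\<bar>t\<bar> \<le> \<bar>s\<bar>"
    then show "((\<lambda>t. (dir_deriv v ^^ m) f (p + t *\<^sub>R v)) has_real_derivative
        (dir_deriv v ^^ Suc m) f (p + t *\<^sub>R v)) (at t)"
      using smooth_on_DERIV_line[OF smooth_on_dir_deriv_iter[OF assms(1)] seg] by simp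
  qed
  then show ?thesis by simp
qed

lemma smooth_on_box_bounded:
  assumes "smooth_on f U" "{-r..r} \<times> {-r..r} \<subseteq> U"
  shows "\<exists>C\<ge>0. \<forall>x y. \<bar>x\<bar> \<le> r \<longrightarrow> \<bar>y\<bar> \<le> r \<longrightarrow> \<bar>f (x, y)\<bar> \<le> C"
proof -
  have "compact ({-r..r} \<times> {-r..r})" by (intro compact_Times) auto
  moreover have "continuous_on ({-r..r} \<times> {-r..r}) f"
    using smooth_on_continuous[OF assms(1)] assms(2) continuous_on_subset by blast
  ultimately have "bounded (f ` ({-r..r} \<times> {-r..r}))"
    by (intro compact_imp_bounded compact_continuous_image)
  then obtain C where C: "\<forall>p\<in>{-r..r} \<times> {-r..r}. \<bar>f p\<bar> \<le> C"
    by (auto simp: bounded_iff)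
  \<comment> \<open>For r < 0 the box is empty and \<open>C\<close> may be negative, hence the
    maximum with 0.\<close>
  then have "\<bar>f (x, y)\<bar> \<le> max C 0" if "\<bar>x\<bar> \<le> r" "\<bar>y\<bar> \<le> r" for x y
    using that by (intro max.coboundedI1) (auto simp: abs_le_iff)
  then show ?thesis by (intro exI[of _ "max C 0"]) auto
qed

text \<open>Expanding first in \<open>y\<close> and then in \<open>x\<close> produces the mixed derivatives in exactly the order
  used by \<^const>\<open>taylor_coeff\<close>, so the symmetry of mixed partial derivatives is not needed.\<close>

lemma smooth_on_taylor_bound:
  assumes sm: "smooth_on f U" and box: "{-r..r} \<times> {-r..r} \<subseteq> U" and r: "0 \<le> r" "r \<le> 1"
  shows "\<exists>C\<ge>0. \<forall>x y. \<bar>x\<bar> \<le> r \<longrightarrow> \<bar>y\<bar> \<le> r \<longrightarrow>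
    \<bar>f (x, y)\<bar> \<le> (\<Sum>b<n. \<Sum>a<n. \<bar>taylor_coeff f a b\<bar> * (\<bar>x\<bar> ^ a * \<bar>y\<bar> ^ b)) + C * (\<bar>x\<bar> ^ n + \<bar>y\<bar> ^ n)"
proof -
  let ?X = "(1, 0) :: real \<times> real" and ?Y = "(0, 1) :: real \<times> real"
  let ?Dy = "\<lambda>b. (dir_deriv ?Y ^^ b) f"
  have "\<forall>b. \<exists>C\<ge>0. \<forall>x y. \<bar>x\<bar> \<le> r \<longrightarrow> \<bar>y\<bar> \<le> r \<longrightarrow> \<bar>(dir_deriv ?X ^^ n) (?Dy b) (x, y)\<bar> \<le> C"
    using smooth_on_box_bounded[OF smooth_on_dir_deriv_iter[OF smooth_on_dir_deriv_iter[OF sm]] box]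
    by blast
  then obtain C where C: "\<And>b. C b \<ge> 0"
    "\<And>b x y. \<lbrakk>\<bar>x\<bar> \<le> r; \<bar>y\<bar> \<le> r\<rbrakk> \<Longrightarrow> \<bar>(dir_deriv ?X ^^ n) (?Dy b) (x, y)\<bar> \<le> C b"
    by metis
  obtain C' where C': "C' \<ge> 0" "\<And>x y. \<lbrakk>\<bar>x\<bar> \<le> r; \<bar>y\<bar> \<le> r\<rbrakk> \<Longrightarrow> \<bar>?Dy n (x, y)\<bar> \<le> C'"
    using smooth_on_box_bounded[OF smooth_on_dir_deriv_iter[OF sm] box] by blast
  define K where "K = C' + (\<Sum>b<n. C b)"
  have drop_fact: "\<bar>u / fact m * w\<bar> \<le> \<bar>u\<bar> * \<bar>w\<bar>" for u w :: real and m
    by (auto simp: abs_mult divide_simps intro!: mult_right_mono)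
       (metis abs_ge_zero fact_ge_1 mult_le_cancel_left1 mult_left_mono abs_mult mult.assoc mult_nonneg_nonneg linorder_not_less)
  have tri: "\<bar>u\<bar> \<le> (\<Sum>a<n. \<bar>g a\<bar>) + \<bar>w\<bar>" if "u = (\<Sum>a<n. g a) + w" for u w and g :: "nat \<Rightarrow> real"
    unfolding that by (intro order.trans[OF abs_triangle_ineq] add_mono sum_abs order.refl)
  show ?thesis
  proof (intro exI[of _ K] conjI allI impI)
    show "K \<ge> 0" unfolding K_def using C C' by (auto intro!: sum_nonneg add_nonneg_nonneg)
    fix x y :: real assume x: "\<bar>x\<bar> \<le> r" and y: "\<bar>y\<bar> \<le> r"
    \<comment> \<open>The y-derivative of order b on the x-axis, expanded in x about the origin: its
      coefficients, divided by b!, are the Taylor coefficients of index (a, b).\<close>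
    have x_exp: "\<bar>?Dy b (x, 0)\<bar> / fact b \<le> (\<Sum>a<n. \<bar>taylor_coeff f a b\<bar> * \<bar>x\<bar> ^ a) + C b * \<bar>x\<bar> ^ n"
      for b
    proof -
      obtain t where t: "\<bar>t\<bar> \<le> \<bar>x\<bar>" and eq: "?Dy b ((0, 0) + x *\<^sub>R ?X)
        = (\<Sum>a<n. (dir_deriv ?X ^^ a) (?Dy b) (0, 0) / fact a * x ^ a)
          + (dir_deriv ?X ^^ n) (?Dy b) ((0, 0) + t *\<^sub>R ?X) / fact n * x ^ n"
        using smooth_on_taylor_line[OF smooth_on_dir_deriv_iter[OF sm, where v = ?Y and k = b], of x "(0, 0)" ?X n]
          box x r by (force simp: abs_le_iff)
      have "\<bar>?Dy b (x, 0)\<bar> \<le> (\<Sum>a<n. \<bar>(dir_deriv ?X ^^ a) (?Dy b) (0, 0) / fact a * x ^ a\<bar>)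
          + \<bar>(dir_deriv ?X ^^ n) (?Dy b) (t, 0) / fact n * x ^ n\<bar>"
        by (rule tri) (use eq in simp)
      then have "\<bar>?Dy b (x, 0)\<bar> / fact b \<le> ((\<Sum>a<n. \<bar>(dir_deriv ?X ^^ a) (?Dy b) (0, 0) / fact a * x ^ a\<bar>)
          + \<bar>(dir_deriv ?X ^^ n) (?Dy b) (t, 0) / fact n * x ^ n\<bar>) / fact b"
        by (rule divide_right_mono) simp
      also have "\<dots> = (\<Sum>a<n. \<bar>(dir_deriv ?X ^^ a) (?Dy b) (0, 0) / fact a * x ^ a\<bar> / fact b)
          + \<bar>(dir_deriv ?X ^^ n) (?Dy b) (t, 0) / fact n * x ^ n\<bar> / fact b"
        by (simp only: add_divide_distrib sum_divide_distrib)
      also have "(\<Sum>a<n. \<bar>(dir_deriv ?X ^^ a) (?Dy b) (0, 0) / fact a * x ^ a\<bar> / fact b)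
          = (\<Sum>a<n. \<bar>taylor_coeff f a b\<bar> * \<bar>x\<bar> ^ a)"
        by (intro sum.cong refl) (simp add: taylor_coeff_def abs_mult power_abs)
      also have "\<bar>(dir_deriv ?X ^^ n) (?Dy b) (t, 0) / fact n * x ^ n\<bar> / fact b \<le> C b * \<bar>x\<bar> ^ n"
      proof -
        have "\<bar>(dir_deriv ?X ^^ n) (?Dy b) (t, 0) / fact n * x ^ n\<bar>
           \<le> \<bar>(dir_deriv ?X ^^ n) (?Dy b) (t, 0)\<bar> * \<bar>x ^ n\<bar>" by (rule drop_fact)
        also have "\<dots> \<le> C b * \<bar>x\<bar> ^ n"
          using C(2)[of t 0 b] t x r by (simp add: power_abs mult_right_mono)
        finally have "\<bar>(dir_deriv ?X ^^ n) (?Dy b) (t, 0) / fact n * x ^ n\<bar> \<le> C b * \<bar>x\<bar> ^ n" .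
        moreover have "u / fact b \<le> u" if "u \<ge> 0" for u :: real
          using that by (simp add: divide_le_eq mult_le_cancel_left1)
        ultimately show ?thesis by (meson abs_ge_zero order_trans)
      qed
      finally show ?thesis by simp
    qed
    \<comment> \<open>Expansion in y about (x, 0); its coefficients are then estimated by
      \<open>x_exp\<close>.\<close>
    obtain t where t: "\<bar>t\<bar> \<le> \<bar>y\<bar>" and eq: "f ((x, 0) + y *\<^sub>R ?Y)
        = (\<Sum>b<n. ?Dy b (x, 0) / fact b * y ^ b) + ?Dy n ((x, 0) + t *\<^sub>R ?Y) / fact n * y ^ n"
      using smooth_on_taylor_line[OF sm, of y "(x, 0)" ?Y n] box x y r by (force simp: abs_le_iff)
    have "\<bar>f (x, y)\<bar> \<le> (\<Sum>b<n. \<bar>?Dy b (x, 0) / fact b * y ^ b\<bar>) + \<bar>?Dy n (x, t) / fact n * y ^ n\<bar>"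
      by (rule tri) (use eq in simp)
    also have "\<bar>?Dy n (x, t) / fact n * y ^ n\<bar> \<le> C' * \<bar>y\<bar> ^ n"
    proof -
      have "\<bar>?Dy n (x, t) / fact n * y ^ n\<bar> \<le> \<bar>?Dy n (x, t)\<bar> * \<bar>y ^ n\<bar>" by (rule drop_fact)
      also have "\<dots> \<le> C' * \<bar>y\<bar> ^ n"
        using C'(2)[of x t] t x y by (simp add: power_abs mult_right_mono)
      finally show ?thesis .
    qed
    also have "(\<Sum>b<n. \<bar>?Dy b (x, 0) / fact b * y ^ b\<bar>)
      \<le> (\<Sum>b<n. (\<Sum>a<n. \<bar>taylor_coeff f a b\<bar> * (\<bar>x\<bar> ^ a * \<bar>y\<bar> ^ b)) + C b * \<bar>x\<bar> ^ n)"
    proof (rule sum_mono)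
      fix b
      have yb: "\<bar>y\<bar> ^ b \<le> 1" using y r by (intro power_le_one) auto
      have "\<bar>?Dy b (x, 0) / fact b * y ^ b\<bar> = \<bar>?Dy b (x, 0)\<bar> / fact b * \<bar>y\<bar> ^ b"
        by (simp add: abs_mult power_abs)
      also have "\<dots> \<le> ((\<Sum>a<n. \<bar>taylor_coeff f a b\<bar> * \<bar>x\<bar> ^ a) + C b * \<bar>x\<bar> ^ n) * \<bar>y\<bar> ^ b"
        by (intro mult_right_mono x_exp) auto
      also have "\<dots> \<le> (\<Sum>a<n. \<bar>taylor_coeff f a b\<bar> * (\<bar>x\<bar> ^ a * \<bar>y\<bar> ^ b)) + C b * \<bar>x\<bar> ^ n"
        using mult_left_le[OF yb, of "C b * \<bar>x\<bar> ^ n"] C(1)[of b]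
        by (simp add: distrib_right sum_distrib_right mult.assoc)
      finally show "\<bar>?Dy b (x, 0) / fact b * y ^ b\<bar>
        \<le> (\<Sum>a<n. \<bar>taylor_coeff f a b\<bar> * (\<bar>x\<bar> ^ a * \<bar>y\<bar> ^ b)) + C b * \<bar>x\<bar> ^ n" .
    qed
    also have "\<dots> = (\<Sum>b<n. \<Sum>a<n. \<bar>taylor_coeff f a b\<bar> * (\<bar>x\<bar> ^ a * \<bar>y\<bar> ^ b))
        + (\<Sum>b<n. C b) * \<bar>x\<bar> ^ n"
      by (simp add: sum.distrib sum_distrib_right)
    finally have "\<bar>f (x, y)\<bar> \<le> (\<Sum>b<n. \<Sum>a<n. \<bar>taylor_coeff f a b\<bar> * (\<bar>x\<bar> ^ a * \<bar>y\<bar> ^ b))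
        + ((\<Sum>b<n. C b) * \<bar>x\<bar> ^ n + C' * \<bar>y\<bar> ^ n)" by simp
    moreover have "(\<Sum>b<n. C b) * \<bar>x\<bar> ^ n \<le> K * \<bar>x\<bar> ^ n" "C' * \<bar>y\<bar> ^ n \<le> K * \<bar>y\<bar> ^ n"
      unfolding K_def using C C' by (auto intro!: mult_right_mono sum_nonneg)
    ultimately show "\<bar>f (x, y)\<bar> \<le> (\<Sum>b<n. \<Sum>a<n. \<bar>taylor_coeff f a b\<bar> * (\<bar>x\<bar> ^ a * \<bar>y\<bar> ^ b))
        + K * (\<bar>x\<bar> ^ n + \<bar>y\<bar> ^ n)" by (simp add: distrib_left)
  qed
qed

text \<open>The constants do not depend on the weights \<open>k\<close>, \<open>l\<close>: at a vertex of the Newton polygon an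
  interval of weights is used simultaneously.\<close>

lemma small_on_weighted_box:
  assumes sm: "smooth_on f U" and "(0, 0) \<in> U" and W: "open W" "(0, 0) \<in> W" and "\<sigma> > 0"
  shows "\<exists>K>0. \<exists>e0>0. e0 \<le> 1 \<and> (\<forall>e k l x y. 0 < e \<longrightarrow> e \<le> e0 \<longrightarrow> \<sigma> \<le> k \<longrightarrow> \<sigma> \<le> l \<longrightarrow>
    (\<forall>a b. taylor_coeff f a b \<noteq> 0 \<longrightarrow> k * real a + l * real b \<ge> 1) \<longrightarrow>
    \<bar>x\<bar> \<le> e powr k \<longrightarrow> \<bar>y\<bar> \<le> e powr l \<longrightarrow> (x, y) \<in> W \<and> \<bar>f (x, y)\<bar> \<le> K * e)"
proof -
  have "open (U \<inter> W)" "(0, 0) \<in> U \<inter> W" using assms by (auto simp: smooth_on_def)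
  then obtain A B where AB: "open A" "open B" "0 \<in> A" "0 \<in> B" "A \<times> B \<subseteq> U \<inter> W"
    by (metis mem_Sigma_iff open_prod_def)
  then obtain r1 r2 where r1: "r1 > 0" "cball 0 r1 \<subseteq> A" and r2: "r2 > 0" "cball 0 r2 \<subseteq> B"
    by (meson open_contains_cball)
  define r where "r = min 1 (min r1 r2)"
  have r: "0 < r" "r \<le> 1" using r1 r2 by (auto simp: r_def)
  have box: "{-r..r} \<times> {-r..r} \<subseteq> U \<inter> W"
  proof -
    have "{-r..r} \<subseteq> A" "{-r..r} \<subseteq> B" using r1 r2 by (auto simp: r_def subset_iff dist_real_def abs_le_iff)
    then show ?thesis using AB(5) by blast
  qed
  \<comment> \<open>With n \<sigma> \<ge> 1 the remainders are harmless: on the box |x|^n \<le> e^(k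
    n) \<le> e, and likewise for y.\<close>
  define n where "n = nat \<lceil>1 / \<sigma>\<rceil>"
  have n: "real n * \<sigma> \<ge> 1"
    using \<open>\<sigma> > 0\<close> real_nat_ceiling_ge[of "1 / \<sigma>"] unfolding n_def
    by (simp only: pos_divide_le_eq)
  obtain C where C: "C \<ge> 0" "\<And>x y. \<lbrakk>\<bar>x\<bar> \<le> r; \<bar>y\<bar> \<le> r\<rbrakk> \<Longrightarrow>
    \<bar>f (x, y)\<bar> \<le> (\<Sum>b<n. \<Sum>a<n. \<bar>taylor_coeff f a b\<bar> * (\<bar>x\<bar> ^ a * \<bar>y\<bar> ^ b)) + C * (\<bar>x\<bar> ^ n + \<bar>y\<bar> ^ n)"
    using smooth_on_taylor_bound[OF sm, of r n] box r by auto
  define G where "G = (\<Sum>b<n. \<Sum>a<n. \<bar>taylor_coeff f a b\<bar>)"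
  \<comment> \<open>\<open>G\<close> collects the Taylor monomials, 2 C the two remainders, and 1
    makes \<open>K\<close> positive.\<close>
  define K where "K = G + 2 * C + 1"
  have "G \<ge> 0" unfolding G_def by (intro sum_nonneg) auto
  then have "K > 0" using C(1) by (simp add: K_def)
  \<comment> \<open>For e \<le> e0 this gives e^\<sigma> \<le> r, so every admissible weighted box
    lies in the square of half-side r.\<close>
  define e0 where "e0 = r powr (1 / \<sigma>)"
  have e0: "e0 > 0" "e0 \<le> 1" using r \<open>\<sigma> > 0\<close> by (auto simp: e0_def powr_le1)
  have "(x, y) \<in> W \<and> \<bar>f (x, y)\<bar> \<le> K * e"
    if e: "0 < e" "e \<le> e0" and k: "\<sigma> \<le> k" and l: "\<sigma> \<le> l"
      and kl: "\<And>a b. taylor_coeff f a b \<noteq> 0 \<Longrightarrow> k * real a + l * real b \<ge> 1"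
      and x: "\<bar>x\<bar> \<le> e powr k" and y: "\<bar>y\<bar> \<le> e powr l" for e k l x y
  proof -
    have e1: "e \<le> 1" using e e0 by simp
    have anti: "e powr q \<le> e powr p" if "p \<le> q" for p q
      using that e e1 by (simp add: powr_mono')
    have "e powr \<sigma> \<le> e0 powr \<sigma>" using e \<open>\<sigma> > 0\<close> by (intro powr_mono2) auto
    also have "\<dots> = r" using r \<open>\<sigma> > 0\<close> by (simp add: e0_def powr_powr)
    finally have er: "e powr \<sigma> \<le> r" .
    have xr: "\<bar>x\<bar> \<le> r" "\<bar>y\<bar> \<le> r" using x y er anti[OF k] anti[OF l] by linarith+
    have pw: "\<bar>x\<bar> ^ a \<le> e powr (k * real a)" "\<bar>y\<bar> ^ a \<le> e powr (l * real a)" for a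
      using power_mono[OF x, of a] power_mono[OF y, of a] e
      by (simp_all add: powr_powr[symmetric] powr_realpow)
    have mon: "\<bar>taylor_coeff f a b\<bar> * (\<bar>x\<bar> ^ a * \<bar>y\<bar> ^ b) \<le> \<bar>taylor_coeff f a b\<bar> * e" for a b
    proof (cases "taylor_coeff f a b = 0")
      case False
      have "\<bar>x\<bar> ^ a * \<bar>y\<bar> ^ b \<le> e powr (k * real a) * e powr (l * real b)"
        by (intro mult_mono pw) auto
      also have "\<dots> = e powr (k * real a + l * real b)" by (simp add: powr_add)
      also have "\<dots> \<le> e powr 1" by (intro anti kl False)
      finally show ?thesis using e by (intro mult_left_mono) auto
    qed auto
    have "1 \<le> k * real n" "1 \<le> l * real n"
      using n mult_right_mono[OF k, of "real n"] mult_right_mono[OF l, of "real n"]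
      by (simp_all add: mult.commute)
    then have rem: "\<bar>x\<bar> ^ n \<le> e" "\<bar>y\<bar> ^ n \<le> e"
      using pw[of n] anti[of 1 "k * real n"] anti[of 1 "l * real n"] e by fastforce+
    have "\<bar>f (x, y)\<bar> \<le> (\<Sum>b<n. \<Sum>a<n. \<bar>taylor_coeff f a b\<bar> * (\<bar>x\<bar> ^ a * \<bar>y\<bar> ^ b))
        + C * (\<bar>x\<bar> ^ n + \<bar>y\<bar> ^ n)" by (intro C xr)
    also have "\<dots> \<le> (\<Sum>b<n. \<Sum>a<n. \<bar>taylor_coeff f a b\<bar> * e) + C * (e + e)"
      by (intro add_mono sum_mono mon mult_left_mono rem C)
    also have "(\<Sum>b<n. \<Sum>a<n. \<bar>taylor_coeff f a b\<bar> * e) = G * e"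
      unfolding G_def sum_distrib_right ..
    also have "G * e + C * (e + e) = (K - 1) * e" by (simp add: K_def algebra_simps)
    also have "\<dots> \<le> K * e" using e by (simp add: algebra_simps)
    finally show ?thesis using box xr by (auto simp: abs_le_iff)
  qed
  then show ?thesis using \<open>K > 0\<close> e0 by blast
qed

subsection \<open>Supporting lines of the Newton polygon\<close>

lemma convex_newton_polygon: "convex (newton_polygon S)"
  by (simp add: newton_polygon_def convex_convex_hull)

lemma newton_polygon_mem:
  assumes "taylor_coeff S a b \<noteq> 0" "real a \<le> x" "real b \<le> y"
  shows "(x, y) \<in> newton_polygon S"
  unfolding newton_polygon_def by (rule hull_inc) (use assms in auto)

text \<open>Nonnegative weights put each generating quadrant into the half-plane, which is convex
  and hence contains the hull.\<close>

lemma newton_polygon_halfplane: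
  assumes "\<And>a b. taylor_coeff S a b \<noteq> 0 \<Longrightarrow> c \<le> k * real a + l * real b" "0 \<le> k" "0 \<le> l"
    and p: "p \<in> newton_polygon S"
  shows "c \<le> k * fst p + l * snd p"
proof -
  have "newton_polygon S \<subseteq> {p. (k, l) \<bullet> p \<ge> c}"
    unfolding newton_polygon_def
  proof (rule hull_minimal, safe)
    fix a b x y assume "taylor_coeff S a b \<noteq> 0" "real a \<le> x" "real b \<le> y"
    then show "(k, l) \<bullet> (x, y) \<ge> c"
      using assms(1)[of a b] mult_left_mono[of "real a" x k] mult_left_mono[of "real b" y l] assms(2,3)
      by simp
  qed (rule convex_halfspace_ge)
  then show ?thesis using p by (auto simp: inner_prod_def)
qed

text \<open>The union of quadrants is mapped into itself by such a translation, and translations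
  commute with convex hulls.\<close>

lemma newton_polygon_add:
  assumes "p \<in> newton_polygon S" "0 \<le> fst q" "0 \<le> snd q"
  shows "q + p \<in> newton_polygon S"
proof -
  let ?G = "\<Union>(a, b) \<in> {(a, b). taylor_coeff S a b \<noteq> 0}. {(t1, t2). t1 \<ge> real a \<and> t2 \<ge> real b}"
  have "q + p \<in> (+) q ` (convex hull ?G)" using assms(1) by (auto simp: newton_polygon_def)
  also have "\<dots> = convex hull ((+) q ` ?G)" by (simp add: convex_hull_translation)
  also have "\<dots> \<subseteq> convex hull ?G"
    using assms(2,3) by (intro hull_mono) (cases q; force)
  finally show ?thesis by (simp add: newton_polygon_def)
qed

text \<open>A line separating the polygon from the open part t < d of the bisectrix has nonnegative
  weights, because the polygon contains whole quadrants. It is then normalised to take the value 1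
  at (d, d).\<close>

lemma newton_polygon_supporting_line:
  assumes ne: "\<exists>a b. taylor_coeff S a b \<noteq> 0" and d: "d = newton_distance S" "0 < d"
  obtains k l where "0 \<le> k" "0 \<le> l" "(k + l) * d = 1"
    "\<And>a b. taylor_coeff S a b \<noteq> 0 \<Longrightarrow> k * real a + l * real b \<ge> 1"
proof -
  let ?N = "newton_polygon S" and ?D = "(\<lambda>t. (t, t)) ` {..<d}"
  obtain a0 b0 where ab0: "taylor_coeff S a0 b0 \<noteq> 0" using ne by blast
  have "linear (\<lambda>t::real. (t, t))" by (rule linearI) auto
  then have "convex ?D" by (intro convex_linear_image) auto
  moreover have "?N \<inter> ?D = {}"
  proof -
    have "bdd_below {t. (t, t) \<in> ?N}"
      using newton_polygon_halfplane[of S 0 1 0] by (intro bdd_belowI[of _ 0]) auto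
    then have "d \<le> t" if "(t, t) \<in> ?N" for t
      unfolding d newton_distance_def using that by (intro cInf_lower) auto
    then show ?thesis by fastforce
  qed
  moreover have "?N \<noteq> {}" "?D \<noteq> {}" using newton_polygon_mem[OF ab0] by auto
  ultimately obtain v c where v: "v \<noteq> 0" "\<And>p. p \<in> ?D \<Longrightarrow> v \<bullet> p \<le> c" "\<And>p. p \<in> ?N \<Longrightarrow> c \<le> v \<bullet> p"
    using separating_hyperplane_sets[of ?D ?N] convex_newton_polygon
    by (metis (no_types, lifting) Int_commute)
  obtain k l where kl: "v = (k, l)" by (cases v)
  have N: "c \<le> k * x + l * y" if "(x, y) \<in> ?N" for x y using v(3)[OF that] kl by simp
  have D: "(k + l) * t \<le> c" if "t < d" for t using v(2)[of "(t, t)"] that kl by (auto simp: algebra_simps)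
  \<comment> \<open>An affine function that is bounded below on the half-line has nonnegative slope;
    it is used along both sides of the quadrant at (a0, b0).\<close>
  have nonneg: "0 \<le> m" if "\<And>s. 0 \<le> s \<Longrightarrow> c \<le> e + m * s" for m e :: real
  proof (rule ccontr)
    assume "\<not> 0 \<le> m"
    then have "m < 0" by simp
    have "c \<le> e + m * ((\<bar>c - e\<bar> + 1) / (- m))"
      using \<open>m < 0\<close> by (intro that divide_nonneg_pos) auto
    also have "m * ((\<bar>c - e\<bar> + 1) / (- m)) = - (\<bar>c - e\<bar> + 1)"
      using \<open>m < 0\<close> by (simp add: field_simps)
    finally show False by linarith
  qed
  have k: "0 \<le> k"
  proof (rule nonneg[of "k * real a0 + l * real b0"])
    fix s :: real assume "0 \<le> s"
    then show "c \<le> k * real a0 + l * real b0 + k * s"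
      using N[OF newton_polygon_mem[OF ab0], of "real a0 + s" "real b0"] by (simp add: algebra_simps)
  qed
  have l: "0 \<le> l"
  proof (rule nonneg[of "k * real a0 + l * real b0"])
    fix s :: real assume "0 \<le> s"
    then show "c \<le> k * real a0 + l * real b0 + l * s"
      using N[OF newton_polygon_mem[OF ab0], of "real a0" "real b0 + s"] by (simp add: algebra_simps)
  qed
  have "k + l > 0" using k l v(1) kl by (cases "k = 0"; cases "l = 0") (auto simp: zero_prod_def)
  \<comment> \<open>Separation is known only for t < d. Were the limit inequality false, the
    midpoint of c/(k+l) and d would violate it.\<close>
  have cd: "(k + l) * d \<le> c"
  proof (rule ccontr)
    assume *: "\<not> (k + l) * d \<le> c"
    define t where "t = (d + c / (k + l)) / 2"
    have "c / (k + l) < d" using * \<open>k + l > 0\<close> by (simp add: pos_divide_less_eq mult.commute)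
    then have "t < d" by (simp add: t_def)
    moreover have "(k + l) * t = ((k + l) * d + c) / 2"
      using \<open>k + l > 0\<close> by (simp add: t_def field_simps)
    ultimately show False using D[of t] * by simp
  qed
  define m where "m = (k + l) * d"
  have "m > 0" using \<open>k + l > 0\<close> d by (simp add: m_def)
  show ?thesis
  proof (rule that[of "k / m" "l / m"])
    show "(k / m + l / m) * d = 1"
      using \<open>m > 0\<close> by (simp add: add_divide_distrib[symmetric]) (simp add: m_def)
    fix a b assume "taylor_coeff S a b \<noteq> 0"
    then have "m \<le> k * real a + l * real b" using N[OF newton_polygon_mem[of S a b "real a" "real b"]] cd by (simp add: m_def)
    then show "k / m * real a + l / m * real b \<ge> 1"
      using \<open>m > 0\<close> by (simp add: add_divide_distrib[symmetric] pos_le_divide_eq)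
  qed (use k l \<open>m > 0\<close> in auto)
qed

section \<open>Edges of the Newton polygon and positivity of the weights\<close>

text \<open>For every r > 0 the point p + r v is in the polygon, and p lies strictly between it and
  p - s v. The face property puts p + r v into the face, for arbitrarily large r.\<close>

lemma face_of_newton_polygon_unbounded:
  assumes e: "e face_of newton_polygon S" and "p \<in> e" "p - s *\<^sub>R v \<in> e"
    and "0 < s" "v \<noteq> 0" "0 \<le> fst v" "0 \<le> snd v"
  shows "\<not> bounded e"
proof
  assume "bounded e"
  then obtain B where B: "\<And>q. q \<in> e \<Longrightarrow> norm q \<le> B" by (auto simp: bounded_iff)
  have sub: "e \<subseteq> newton_polygon S" using e by (rule face_of_imp_subset)
  have in_e: "p + r *\<^sub>R v \<in> e" if "0 < r" for r
  proof -
    have "r *\<^sub>R v + p \<in> newton_polygon S"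
      using assms that sub by (intro newton_polygon_add) auto
    moreover have "p \<in> open_segment (p - s *\<^sub>R v) (p + r *\<^sub>R v)"
      unfolding in_segment
    proof (intro conjI exI[of _ "s / (s + r)"])
      have "(1 - s / (s + r)) *\<^sub>R (p - s *\<^sub>R v) + (s / (s + r)) *\<^sub>R (p + r *\<^sub>R v)
        = p + (s / (s + r) * r - (1 - s / (s + r)) * s) *\<^sub>R v"
        by (simp add: algebra_simps)
      also have "s / (s + r) * r - (1 - s / (s + r)) * s = 0"
        using assms that by (simp add: field_simps)
      finally show "p = (1 - s / (s + r)) *\<^sub>R (p - s *\<^sub>R v) + (s / (s + r)) *\<^sub>R (p + r *\<^sub>R v)" by simp
      show "p - s *\<^sub>R v \<noteq> p + r *\<^sub>R v"
      proof
        assume "p - s *\<^sub>R v = p + r *\<^sub>R v"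
        then have "(s + r) *\<^sub>R v = 0" by (simp add: algebra_simps)
        then show False using assms that by simp
      qed
    qed (use assms that in auto)
    ultimately show ?thesis
      using e assms sub unfolding face_of_def by (metis add.commute subsetD)
  qed
  have "0 \<le> B" using B[OF \<open>p \<in> e\<close>] norm_ge_zero order_trans by blast
  \<comment> \<open>Chosen so that r v has norm B + |p| + 1, which drives p + r v out of the ball of
    radius B.\<close>
  define r where "r = (B + norm p + 1) / norm v"
  have "r > 0" using \<open>v \<noteq> 0\<close> \<open>0 \<le> B\<close> by (auto simp: r_def intro!: divide_pos_pos add_nonneg_pos)
  have "B + norm p + 1 = norm (r *\<^sub>R v)" using \<open>0 \<le> B\<close> \<open>v \<noteq> 0\<close> by (simp add: r_def)
  also have "\<dots> = norm ((p + r *\<^sub>R v) - p)" by simp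
  also have "\<dots> \<le> norm (p + r *\<^sub>R v) + norm p" by (rule norm_triangle_ineq4)
  finally show False using B[OF in_e[OF \<open>r > 0\<close>]] by simp
qed

text \<open>The functional with weights k, l is at least 1 on the edge and equals 1 at a relative
  interior point, so it is constant along the edge. A vanishing weight would make the edge parallel
  to an axis and therefore unbounded.\<close>

lemma compact_edge_weights_pos:
  assumes e: "e edge_of newton_polygon S" "compact e" "(d, d) \<in> rel_interior e"
    and kl: "0 \<le> k" "0 \<le> l" "(k + l) * d = 1"
      "\<And>a b. taylor_coeff S a b \<noteq> 0 \<Longrightarrow> k * real a + l * real b \<ge> 1"
  shows "0 < k" "0 < l"
proof -
  have face: "e face_of newton_polygon S" and dim: "aff_dim e = 1" using e(1) by (auto simp: edge_of_def)
  have sub: "e \<subseteq> newton_polygon S" using face by (rule face_of_imp_subset)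
  have de: "(d, d) \<in> e" using e(3) rel_interior_subset by blast
  have "e \<noteq> {(d, d)}" using dim aff_dim_sing[of "(d, d)"] by auto
  then have "\<exists>q\<in>e. q \<noteq> (d, d)" using de by blast
  then obtain x y where q: "(x, y) \<in> e" "(x, y) \<noteq> (d, d)" by (metis surj_pair)
  \<comment> \<open>Relative interiority lets the segment from (x, y) through (d, d) be prolonged
    within the edge; \<open>z\<close> is its new end.\<close>
  obtain m where m: "1 < m" "(1 - m) *\<^sub>R (x, y) + m *\<^sub>R (d, d) \<in> e"
    using e(3) q(1) convex_rel_interior_if[of e "(d, d)"] face_of_imp_convex[OF face] convex_newton_polygon
    by (metis (no_types, lifting) convex_rel_interior_iff empty_iff)
  define z where "z = (1 - m) *\<^sub>R (x, y) + m *\<^sub>R (d, d)"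
  have z: "z \<in> e" "z = (d + (m - 1) * (d - x), d + (m - 1) * (d - y))"
    using m by (auto simp: z_def algebra_simps)
  have half: "1 \<le> k * fst p + l * snd p" if "p \<in> e" for p
    using newton_polygon_halfplane[of S 1 k l p] kl that sub by auto
  have "1 \<le> k * x + l * y" using half[OF q(1)] by simp
  \<comment> \<open>At \<open>z\<close> the excess over 1 is -(m - 1) times the excess at (x, y).
    Both are nonnegative, so both vanish.\<close>
  moreover have "k * (d + (m - 1) * (d - x)) + l * (d + (m - 1) * (d - y))
      = (k + l) * d * m - (m - 1) * (k * x + l * y)"
    by (simp add: algebra_simps)
  then have "k * (d + (m - 1) * (d - x)) + l * (d + (m - 1) * (d - y))
      = 1 + (m - 1) * (1 - (k * x + l * y))"
    unfolding kl(3) by (simp add: algebra_simps)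
  ultimately have line: "k * x + l * y = 1"
    using half[OF z(1)] z(2) m(1) by (simp add: zero_le_mult_iff)
  \<comment> \<open>Of the two edge points (x, y) and \<open>z\<close> on opposite sides of (d, d),
    one has the form (d, d) - s v with s > 0, as the unboundedness lemma requires.\<close>
  have no: False if "v \<in> {(1, 0), (0, 1)}" "s \<noteq> 0" "(x, y) = (d, d) - s *\<^sub>R v" for v s
  proof -
    have "\<exists>s>0. (d, d) - s *\<^sub>R v \<in> e"
    proof (cases "s > 0")
      case True
      then show ?thesis using that q by metis
    next
      case False
      have "z = (d, d) - (- (m - 1) * s) *\<^sub>R v" using that z(2) by (auto simp: algebra_simps)
      then show ?thesis using z(1) False that(2) m(1)
        by (intro exI[of _ "- (m - 1) * s"]) (auto simp: mult_neg_neg zero_less_mult_iff)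
    qed
    then show False
      using face_of_newton_polygon_unbounded[OF face de, of _ v] that(1) compact_imp_bounded[OF e(2)] by (auto simp: zero_prod_def)
  qed
  show "0 < k"
  proof (rule ccontr)
    assume "\<not> 0 < k"
    then have "k = 0" using kl by simp
    then have "l * y = l * d" "l \<noteq> 0" using line kl by auto
    then have "y = d" by simp
    then show False using no[of "(1, 0)" "d - x"] q by auto
  qed
  show "0 < l"
  proof (rule ccontr)
    assume "\<not> 0 < l"
    then have "l = 0" using kl by simp
    then have "k * x = k * d" "k \<noteq> 0" using line kl by auto
    then have "x = d" by simp
    then show False using no[of "(0, 1)" "d - y"] q by auto
  qed
qed

text \<open>The minimum is attained although \<open>P\<close> may be infinite. At a vertex of the Newton polygon this
  gives a strict gap between the constraints from the points on either side.\<close>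

lemma steepest_point:
  fixes P :: "(nat \<times> nat) set" and n :: nat
  obtains \<beta> where "0 < \<beta>" "\<beta> \<le> 1"
    "\<And>a b. \<lbrakk>(a, b) \<in> P; a < n; n < b\<rbrakk> \<Longrightarrow> \<beta> \<le> (real b - real n) / (real b - real a)"
    "\<beta> = 1 \<or> (\<exists>a b. (a, b) \<in> P \<and> a < n \<and> n < b \<and> \<beta> = (real b - real n) / (real b - real a))"
proof -
  \<comment> \<open>For a < n < b this is the largest x with x a + (1 - x) b \<ge> n.\<close>
  define val where "val p = (real (snd p) - real n) / (real (snd p) - real (fst p))" for p :: "nat \<times> nat"
  define L where "L = {p \<in> P. fst p < n \<and> n < snd p}"
  have "\<exists>\<beta>>0. \<beta> \<le> 1 \<and> (\<forall>p\<in>L. \<beta> \<le> val p) \<and> (\<beta> = 1 \<or> (\<exists>p\<in>L. \<beta> = val p))"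
  proof (cases "L = {}")
    case True
    \<comment> \<open>Without points on this side there is no constraint, and 1 is the
      default.\<close>
    then show ?thesis by (intro exI[of _ 1]) auto
  next
    case False
    then obtain a0 b0 where p0: "(a0, b0) \<in> L" by auto
    then have a0: "a0 < n" "n < b0" by (auto simp: L_def)
    \<comment> \<open>Above this height the value exceeds or equals that of (a0, b0): the ratio (b -
      n)/(n - a) is at least (b - n)/n, which beats (b0 - n)/(n - a0). The minimum is thus attained
      on the finite set \<open>F\<close>.\<close>
    define F where "F = {p \<in> L. snd p \<le> n + (b0 - n) * n}"
    have "F \<subseteq> {..<n} \<times> {..n + (b0 - n) * n}" by (auto simp: F_def L_def)
    then have "finite F" using finite_subset by blast
    have p0F: "(a0, b0) \<in> F"
    proof -
      have "(b0 - n) * 1 \<le> (b0 - n) * n" using a0 by (intro mult_le_mono2) auto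
      then have "b0 \<le> n + (b0 - n) * n" using a0 by linarith
      then show ?thesis using p0 by (simp add: F_def)
    qed
    define \<beta> where "\<beta> = Min (val ` F)"
    have "\<beta> \<in> val ` F" unfolding \<beta>_def using \<open>finite F\<close> p0F by (intro Min_in) auto
    then obtain p where p: "p \<in> L" "\<beta> = val p" by (auto simp: F_def)
    have "\<beta> \<le> val q" if q: "q \<in> L" for q
    proof (cases "q \<in> F")
      case True
      then show ?thesis using \<open>finite F\<close> by (simp add: \<beta>_def)
    next
      case False
      obtain a b where ab: "q = (a, b)" "a < n" "n < b" using q by (cases q) (auto simp: L_def)
      then have "n + (b0 - n) * n < b" using False q by (simp add: F_def)
      then have *: "(b0 - n) * n < b - n" by linarith
      have "(real b0 - real n) * (real n - real a) \<le> (real b0 - real n) * real n"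
        using a0 by (intro mult_left_mono) auto
      also have "\<dots> \<le> real b - real n"
        using * a0 ab by (metis less_imp_le of_nat_diff of_nat_le_iff of_nat_mult)
      also have "\<dots> \<le> (real b - real n) * (real n - real a0)"
        using a0 ab mult_left_mono[of 1 "real n - real a0" "real b - real n"] by simp
      finally have "val (a0, b0) \<le> val (a, b)"
        using a0 ab by (simp add: val_def divide_simps) (simp add: algebra_simps)
      moreover have "\<beta> \<le> val (a0, b0)" using \<open>finite F\<close> p0F by (simp add: \<beta>_def)
      ultimately show ?thesis using ab by simp
    qed
    moreover have "0 < val p" "val p \<le> 1" using p(1) by (auto simp: val_def L_def divide_simps)
    ultimately show ?thesis using p by auto
  qed
  then obtain \<beta> where \<beta>: "0 < \<beta>" "\<beta> \<le> 1" "\<forall>p\<in>L. \<beta> \<le> val p" "\<beta> = 1 \<or> (\<exists>p\<in>L. \<beta> = val p)"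
    by blast
  show thesis
  proof (rule that[OF \<beta>(1,2)])
    show "\<beta> = 1 \<or> (\<exists>a b. (a, b) \<in> P \<and> a < n \<and> n < b \<and> \<beta> = (real b - real n) / (real b - real a))"
      using \<beta>(4) by (force simp: L_def val_def)
  qed (use \<beta>(3) in \<open>force simp: L_def val_def\<close>)
qed

text \<open>Write x = k d. Support points to the upper left of the vertex require x \<le> \<beta>,
  those to the lower right x \<ge> 1 - \<gamma>. If no interval remained between these bounds, a
  segment between extremal points of the two sides, moved to the right, would contain (d, d) in its
  interior.\<close>

lemma vertex_weights:
  assumes "bisectrix_at_vertex S" and d: "d = newton_distance S" "0 < d"
  obtains k0 k1 where "0 < k0" "k0 < k1" "k1 < 1 / d"
    "\<And>k a b. \<lbrakk>k0 \<le> k; k \<le> k1; taylor_coeff S a b \<noteq> 0\<rbrakk> \<Longrightarrow> k * real a + (1 / d - k) * real b \<ge> 1"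
proof -
  let ?N = "newton_polygon S"
  have ext: "(d, d) extreme_point_of ?N" using assms by (simp add: bisectrix_at_vertex_def)
  have mid: "False" if "p \<in> ?N" "q \<in> ?N" "(d, d) = (1 - u) *\<^sub>R p + u *\<^sub>R q" "0 < u" "u < 1" "p \<noteq> q" for p q u
    using ext that by (auto simp: extreme_point_of_def in_segment)
  \<comment> \<open>Otherwise (d, d) is the midpoint of (a, b) and its reflection, which lies in the
    quadrant at (a, b).\<close>
  have below: "(real a, real b) = (d, d)" if "taylor_coeff S a b \<noteq> 0" "real a \<le> d" "real b \<le> d" for a b
  proof (rule ccontr)
    assume "(real a, real b) \<noteq> (d, d)"
    then show False
      using that by (intro mid[of "(real a, real b)" "(2 * d - real a, 2 * d - real b)" "1 / 2"])
        (auto intro!: newton_polygon_mem simp: field_simps)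
  qed
  \<comment> \<open>An extreme point of a hull belongs to the generating set, so (d, d) is in some
    quadrant, and \<open>below\<close> identifies it with the corner. Hence d is an integer.\<close>
  obtain n where n: "d = real n"
    using extreme_point_of_convex_hull[OF ext[unfolded newton_polygon_def]] below by fastforce
  define val where "val p = (real (snd p) - real n) / (real (snd p) - real (fst p))" for p :: "nat \<times> nat"
  define P where "P = {(a, b). taylor_coeff S a b \<noteq> 0}"
  \<comment> \<open>Exchanging coordinates turns the lower right side into the upper left
    one.\<close>
  define Q where "Q = {(b, a). taylor_coeff S a b \<noteq> 0}"
  obtain \<beta> where \<beta>: "0 < \<beta>" "\<beta> \<le> 1" "\<And>a b. \<lbrakk>(a, b) \<in> P; a < n; n < b\<rbrakk> \<Longrightarrow> \<beta> \<le> val (a, b)"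
    "\<beta> = 1 \<or> (\<exists>a b. (a, b) \<in> P \<and> a < n \<and> n < b \<and> \<beta> = val (a, b))"
    unfolding val_def fst_conv snd_conv by (rule steepest_point[of P n]) blast
  obtain \<gamma> where \<gamma>: "0 < \<gamma>" "\<gamma> \<le> 1" "\<And>a b. \<lbrakk>(a, b) \<in> Q; a < n; n < b\<rbrakk> \<Longrightarrow> \<gamma> \<le> val (a, b)"
    "\<gamma> = 1 \<or> (\<exists>a b. (a, b) \<in> Q \<and> a < n \<and> n < b \<and> \<gamma> = val (a, b))"
    unfolding val_def fst_conv snd_conv by (rule steepest_point[of Q n]) blast
  have "1 - \<gamma> < \<beta>"
  proof (rule ccontr)
    assume neg: "\<not> 1 - \<gamma> < \<beta>"
    \<comment> \<open>The default value 1 is excluded on both sides: \<beta> = 1 would force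
      \<gamma> \<le> 0, and \<gamma> = 1 would force \<beta> \<le> 0.\<close>
    then obtain a b a' b' where
      L: "taylor_coeff S a b \<noteq> 0" "a < n" "n < b" "\<beta> = val (a, b)" and
      R: "taylor_coeff S a' b' \<noteq> 0" "b' < n" "n < a'" "\<gamma> = val (b', a')"
      using \<beta>(1,4) \<gamma>(1,4) by (auto simp: P_def Q_def)
    define u where "u = d - real a"
    define v where "v = real b - d"
    define u' where "u' = real a' - d"
    define v' where "v' = d - real b'"
    note defs = u_def v_def u'_def v'_def
    have pos: "0 < u" "0 < v" "0 < u'" "0 < v'" using L R n by (auto simp: defs)
    have ab: "real a = d - u" "real b = d + v" "real a' = d + u'" "real b' = d - v'" by (auto simp: defs)
    have "\<beta> = v / (v + u)" "\<gamma> = u' / (u' + v')"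
      using L(4) R(4) n by (auto simp: val_def defs)
    with neg have "v / (v + u) \<le> 1 - u' / (u' + v')" by simp
    also have "\<dots> = v' / (u' + v')" using pos by (simp add: field_simps)
    finally have "v * u' \<le> u * v'" using pos by (simp add: divide_simps) (simp add: algebra_simps)
    \<comment> \<open>The segment from (a, b) to (a', b') meets height d at abscissa d - s, with
      parameter v/(v + v'). Shifting both ends right by s stays in the polygon and hits (d,
      d).\<close>
    define s where "s = (u * v' - v * u') / (v + v')"
    have s: "0 \<le> s" using \<open>v * u' \<le> u * v'\<close> pos by (simp add: s_def)
    show False
    proof (rule mid[of "(real a + s, real b)" "(real a' + s, real b')" "v / (v + v')"])
      have "(1 - v / (v + v')) * (real a + s) + v / (v + v') * (real a' + s)
          = d + s - (u - v / (v + v') * (u + u'))"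
      proof -
        have "(1 - r) * (d - u + s) + r * (d + u' + s) = d + s - (u - r * (u + u'))" for r
          by (simp add: algebra_simps)
        then show ?thesis by (simp only: ab)
      qed
      also have "u - v / (v + v') * (u + u') = s"
        using pos by (simp add: s_def field_simps)
      finally have "(1 - v / (v + v')) * (real a + s) + v / (v + v') * (real a' + s) = d" by simp
      moreover have "(1 - v / (v + v')) * real b + v / (v + v') * real b' = d"
      proof -
        have "(1 - r) * (d + v) + r * (d - v') = d + v - r * (v + v')" for r
          by (simp add: algebra_simps)
        then show ?thesis using pos by (simp only: ab) simp
      qed
      ultimately show "(d, d) = (1 - v / (v + v')) *\<^sub>R (real a + s, real b) + (v / (v + v')) *\<^sub>R (real a' + s, real b')"
        by simp
      show "(real a + s, real b) \<in> ?N" using s by (intro newton_polygon_mem[OF L(1)]) auto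
      show "(real a' + s, real b') \<in> ?N" using s by (intro newton_polygon_mem[OF R(1)]) auto
      show "(real a + s, real b) \<noteq> (real a' + s, real b')" using L(3) R(2) by auto
    qed (use pos in auto)
  qed
  \<comment> \<open>The points dividing the interval from 1 - \<gamma> to \<beta> into thirds; they
    stay strictly between 0 and 1.\<close>
  define x0 where "x0 = (2 * (1 - \<gamma>) + \<beta>) / 3"
  define x1 where "x1 = ((1 - \<gamma>) + 2 * \<beta>) / 3"
  have x: "0 < x0" "x0 < x1" "x1 < 1" "1 - \<gamma> < x0" "x1 < \<beta>"
    using \<open>1 - \<gamma> < \<beta>\<close> \<beta>(1,2) \<gamma>(1,2) by (auto simp: x0_def x1_def)
  have key: "0 \<le> x * (real a - d) + (1 - x) * (real b - d)"
    if "x0 \<le> x" "x \<le> x1" and ab: "taylor_coeff S a b \<noteq> 0" for x a b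
  proof -
    consider "d \<le> real a" "d \<le> real b" | "real a \<le> d" "real b \<le> d" | "a < n" "n < b" | "n < a" "b < n"
      using n by fastforce
    then show ?thesis
    proof cases
      case 1
      then show ?thesis using that x by auto
    next
      case 2
      then show ?thesis using below[OF ab] by auto
    next
      case 3
      then have "x \<le> (real b - real n) / (real b - real a)"
        using \<beta>(3)[of a b] ab x that by (simp add: P_def val_def)
      then have "x * (real b - real a) \<le> real b - real n" using 3 by (simp add: pos_le_divide_eq)
      then show ?thesis by (simp add: n algebra_simps)
    next
      case 4
      then have "1 - x \<le> (real a - real n) / (real a - real b)"
        using \<gamma>(3)[of b a] ab x that by (simp add: Q_def val_def)
      then have "(1 - x) * (real a - real b) \<le> real a - real n" using 4 by (simp add: pos_le_divide_eq)
      then show ?thesis by (simp add: n algebra_simps)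
    qed
  qed
  show ?thesis
  proof (rule that[of "x0 / d" "x1 / d"])
    fix k a b assume k: "x0 / d \<le> k" "k \<le> x1 / d" and ab: "taylor_coeff S a b \<noteq> 0"
    have "0 \<le> k * d * (real a - d) + (1 - k * d) * (real b - d)"
      using k d(2) by (intro key ab) (simp_all add: pos_divide_le_eq pos_le_divide_eq)
    also have "\<dots> = d * (k * real a + (1 / d - k) * real b - 1)"
      using d(2) by (simp add: field_simps)
    finally show "k * real a + (1 / d - k) * real b \<ge> 1" using d(2) by (simp add: zero_le_mult_iff)
  qed (use x d(2) in \<open>auto simp: divide_strict_right_mono\<close>)
qed

subsection \<open>Lower bounds for the oscillatory integral\<close>

lemma emeasure_lborel_box:
  fixes x y :: real
  assumes "0 \<le> x" "0 \<le> y"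
  shows "emeasure lborel ({-x..x} \<times> {-y..y}) = ennreal (4 * x * y)"
proof -
  have "emeasure (lborel \<Otimes>\<^sub>M lborel) ({-x..x} \<times> {-y..y}) = emeasure lborel {-x..x} * emeasure lborel {-y..y}"
    by (rule lborel.emeasure_pair_measure_Times) auto
  also have "\<dots> = ennreal (4 * x * y)"
    using assms by (simp add: emeasure_lborel_Icc ennreal_mult[symmetric])
  finally show ?thesis by (simp add: lborel_prod)
qed

text \<open>The vertical slice over x is [0, s/x], and integrating its length gives the logarithm
  that distinguishes the vertex case.\<close>

lemma emeasure_lborel_hyperbolic:
  fixes a b s :: real
  assumes "0 < a" "a \<le> b" "0 \<le> s"
  defines "A \<equiv> {(x, y). a \<le> x \<and> x \<le> b \<and> 0 \<le> y \<and> x * y \<le> s}"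
  shows "A \<in> sets lborel" "emeasure lborel A = ennreal (s * (ln b - ln a))"
proof -
  have "closed A"
    unfolding A_def case_prod_unfold
    by (intro closed_Collect_conj closed_Collect_le continuous_intros)
  then show meas: "A \<in> sets lborel" by simp
  have "emeasure lborel A = emeasure (lborel \<Otimes>\<^sub>M lborel) A" by (simp add: lborel_prod)
  also have "\<dots> = (\<integral>\<^sup>+x. emeasure lborel (Pair x -` A) \<partial>lborel)"
    using meas by (intro lborel.emeasure_pair_measure_alt) (simp only: lborel_prod)
  also have "\<dots> = (\<integral>\<^sup>+x. ennreal (s / x) * indicator {a..b} x \<partial>lborel)"
  proof (rule nn_integral_cong)
    fix x
    show "emeasure lborel (Pair x -` A) = ennreal (s / x) * indicator {a..b} x"
    proof (cases "x \<in> {a..b}")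
      case True
      then have "Pair x -` A = {0..s / x}"
        using assms by (auto simp: A_def field_simps)
      then show ?thesis using True assms by (simp add: emeasure_lborel_Icc)
    next
      case False
      then have "Pair x -` A = {}" by (auto simp: A_def)
      then show ?thesis using False by simp
    qed
  qed
  also have "\<dots> = s * ln b - s * ln a"
  proof (rule nn_integral_FTC_Icc)
    fix x assume "x \<in> {a..b}"
    then show "((\<lambda>x. s * ln x) has_real_derivative s / x) (at x)" "0 \<le> s / x"
      using assms by (auto intro!: derivative_eq_intros)
  qed (use assms in auto)
  finally show "emeasure lborel A = ennreal (s * (ln b - ln a))" by (simp add: algebra_simps)
qed

text \<open>Decay is required only up to T, so that B may depend on T; at a vertex a factor ln T is
  absorbed into B.\<close>

definition decays_on :: "(real \<Rightarrow> complex) \<Rightarrow> real \<Rightarrow> real \<Rightarrow> real \<Rightarrow> real \<Rightarrow> bool" where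
  "decays_on J \<Lambda> T \<alpha> B \<longleftrightarrow> 0 < \<Lambda> \<and> \<Lambda> \<le> T \<and> \<alpha> < 1 \<and> 0 \<le> B \<and>
     (\<forall>t. \<Lambda> \<le> t \<longrightarrow> t \<le> T \<longrightarrow> cmod (J t) \<le> B * t powr (- \<alpha>))"

text \<open>Specialises the Fourier bound to a neighbourhood on which the amplitude exceeds half its
  value at the origin. The constants are fixed before the set and the decay parameters.\<close>

lemma amplitude_sublevel_bound:
  assumes S: "smooth_on S U" "(0, 0) \<in> U"
    and \<phi>: "smooth_on \<phi> UNIV" "compact (closure {p. \<phi> p \<noteq> 0})" "closure {p. \<phi> p \<noteq> 0} \<subseteq> U"
      "\<And>p. \<phi> p \<ge> 0" "\<phi> (0, 0) > 0"
  obtains I c W where "0 < c" "open W" "(0, 0) \<in> W"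
    "\<And>A T \<Lambda> \<alpha> B. \<lbrakk>A \<in> sets lborel; emeasure lborel A < \<infinity>; A \<subseteq> W; \<forall>p\<in>A. \<bar>S p\<bar> \<le> 1 / T;
      decays_on (osc_integral S \<phi>) \<Lambda> T \<alpha> B\<rbrakk>
      \<Longrightarrow> c * (T * measure lborel A) \<le> \<Lambda> * I + B * T powr (1 - \<alpha>) / (1 - \<alpha>)"
proof -
  let ?K = "closure {p. \<phi> p \<noteq> 0}"
  have cont: "continuous_on UNIV \<phi>" by (rule smooth_on_continuous) fact
  have "open U" using S by (simp add: smooth_on_def)
  \<comment> \<open>S is arbitrary outside U; cutting it off there makes it measurable and leaves
    the integral unchanged, since \<phi> vanishes outside U.\<close>
  define f where "f = (\<lambda>p. indicator U p *\<^sub>R S p)"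
  have f: "f \<in> borel_measurable borel"
    unfolding f_def using \<open>open U\<close> smooth_on_continuous[OF S(1)]
    by (intro borel_measurable_continuous_on_indicator) auto
  have "integrable lborel (\<lambda>p. indicator ?K p *\<^sub>R \<phi> p)"
    using \<phi>(2) continuous_on_subset[OF cont] by (intro borel_integrable_compact) auto
  moreover have "(\<lambda>p. indicator ?K p *\<^sub>R \<phi> p) = \<phi>"
    using closure_subset[of "{p. \<phi> p \<noteq> 0}"] by (auto simp: fun_eq_iff indicator_def)
  ultimately have \<phi>_int: "integrable lborel \<phi>" by simp
  have osc: "osc_integral S \<phi> t = (LINT p|lborel. exp (\<i> * complex_of_real (t * f p)) * complex_of_real (\<phi> p))" for t
    unfolding osc_integral_def
  proof (rule Bochner_Integration.integral_cong)
    fix p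
    have "\<phi> p = 0" if "p \<notin> U" using that \<phi>(3) closure_subset[of "{p. \<phi> p \<noteq> 0}"] by blast
    then show "exp (\<i> * complex_of_real (t * S p)) * complex_of_real (\<phi> p)
        = exp (\<i> * complex_of_real (t * f p)) * complex_of_real (\<phi> p)"
      by (cases "p \<in> U") (auto simp: f_def)
  qed simp
  define c where "c = \<phi> (0, 0) / 2"
  define W where "W = U \<inter> {p. c < \<phi> p}"
  show ?thesis
  proof (rule that[of "c / 4" W "LINT p|lborel. \<phi> p"])
    show "0 < c / 4" using \<phi>(5) by (simp add: c_def)
    show "open W" unfolding W_def
      by (intro open_Int \<open>open U\<close> open_Collect_less cont continuous_intros)
    show "(0, 0) \<in> W" using S \<phi>(5) by (simp add: W_def c_def)
    fix A T \<Lambda> \<alpha> B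
    assume A: "A \<in> sets lborel" "emeasure lborel A < \<infinity>" "A \<subseteq> W" "\<forall>p\<in>A. \<bar>S p\<bar> \<le> 1 / T"
      and "decays_on (osc_integral S \<phi>) \<Lambda> T \<alpha> B"
    then have T: "0 < \<Lambda>" "\<Lambda> \<le> T" "\<alpha> < 1" "0 \<le> B"
      and decay: "\<And>t. \<lbrakk>\<Lambda> \<le> t; t \<le> T\<rbrakk> \<Longrightarrow> cmod (osc_integral S \<phi> t) \<le> B * t powr (- \<alpha>)"
      by (auto simp: decays_on_def)
    have "T / 4 * (c * measure lborel A) \<le> \<Lambda> * (LINT p|lborel. \<phi> p) + B * T powr (1 - \<alpha>) / (1 - \<alpha>)"
    proof (rule sublevel_measure_le_fourier[OF f \<phi>_int \<phi>(4) A(1,2) _ _ _ T])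
      show "0 \<le> c" using \<phi>(5) by (simp add: c_def)
      show "c \<le> \<phi> p" "\<bar>f p\<bar> \<le> 1 / T" if "p \<in> A" for p
        using that A(3,4) by (auto simp: W_def f_def)
    qed (use decay in \<open>simp add: osc\<close>)
    then show "c / 4 * (T * measure lborel A) \<le> \<Lambda> * (LINT p|lborel. \<phi> p) + B * T powr (1 - \<alpha>) / (1 - \<alpha>)"
      by (simp add: mult_ac)
  qed
qed

section \<open>Boxes and hyperbolic regions inside the sublevel sets\<close>

lemma rescaled_powr:
  fixes K T q :: real
  assumes "0 < K" "0 < T"
  shows "T * (1 / (K * T)) powr q = K powr - q * T powr (1 - q)"
  using assms by (simp add: powr_divide powr_mult powr_minus_divide powr_diff field_simps)

locale oscillatory_data =
  fixes S \<phi> :: "real \<times> real \<Rightarrow> real" and U :: "(real \<times> real) set"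
  assumes S: "smooth_on S U" "(0, 0) \<in> U"
    and \<phi>: "smooth_on \<phi> UNIV" "compact (closure {p. \<phi> p \<noteq> 0})" "closure {p. \<phi> p \<noteq> 0} \<subseteq> U"
      "\<And>p. \<phi> p \<ge> 0" "\<phi> (0, 0) > 0"
begin

text \<open>With e = 1/(K T) the weighted box of area 4 e^(k+l) lies in the set |S| \<le> K e = 1/T;
  the threshold on T ensures e \<le> e0.\<close>

lemma decay_ge_box:
  assumes kl: "0 < k" "0 < l" "\<And>a b. taylor_coeff S a b \<noteq> 0 \<Longrightarrow> k * real a + l * real b \<ge> 1"
  obtains I c T0 where "0 < c" "\<forall>T \<Lambda> \<alpha> B. T0 \<le> T \<longrightarrow> decays_on (osc_integral S \<phi>) \<Lambda> T \<alpha> B \<longrightarrow>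
      c * T powr (1 - (k + l)) \<le> \<Lambda> * I + B * T powr (1 - \<alpha>) / (1 - \<alpha>)"
proof -
  obtain I c W where c: "0 < c" and W: "open W" "(0, 0) \<in> W"
    and bound: "\<And>A T \<Lambda> \<alpha> B. \<lbrakk>A \<in> sets lborel; emeasure lborel A < \<infinity>; A \<subseteq> W; \<forall>p\<in>A. \<bar>S p\<bar> \<le> 1 / T;
      decays_on (osc_integral S \<phi>) \<Lambda> T \<alpha> B\<rbrakk>
      \<Longrightarrow> c * (T * measure lborel A) \<le> \<Lambda> * I + B * T powr (1 - \<alpha>) / (1 - \<alpha>)"
    by (rule amplitude_sublevel_bound[OF S \<phi>]) blast
  have "min k l > 0" using kl by simp
  then obtain K e0 where K: "K > 0" "e0 > 0" and small: "\<And>e x y. \<lbrakk>0 < e; e \<le> e0; \<bar>x\<bar> \<le> e powr k; \<bar>y\<bar> \<le> e powr l\<rbrakk>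
      \<Longrightarrow> (x, y) \<in> W \<and> \<bar>S (x, y)\<bar> \<le> K * e"
    using small_on_weighted_box[OF S W, of "min k l"] kl(3) by (metis min.cobounded1 min.cobounded2)
  show ?thesis
  proof (rule that[of "4 * c * K powr - (k + l)" "1 / (K * e0)"]; (intro allI impI)?)
    fix T \<Lambda> \<alpha> B
    assume T: "1 / (K * e0) \<le> T" and decay: "decays_on (osc_integral S \<phi>) \<Lambda> T \<alpha> B"
    define e where "e = 1 / (K * T)"
    define A where "A = {- (e powr k)..e powr k} \<times> {- (e powr l)..e powr l}"
    have "T > 0" using decay by (simp add: decays_on_def)
    have e: "0 < e" "e \<le> e0" using K T \<open>T > 0\<close> by (auto simp: e_def field_simps)
    have em: "emeasure lborel A = ennreal (4 * e powr k * e powr l)"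
      unfolding A_def by (rule emeasure_lborel_box) auto
    have "c * (T * measure lborel A) \<le> \<Lambda> * I + B * T powr (1 - \<alpha>) / (1 - \<alpha>)"
    proof (rule bound[OF _ _ _ _ decay])
      show "A \<in> sets lborel" unfolding A_def by (simp add: borel_closed closed_Times)
      show "A \<subseteq> W" using small[OF e] by (auto simp: A_def abs_le_iff)
      have "K * e = 1 / T" using K \<open>T > 0\<close> by (simp add: e_def)
      then show "\<forall>p\<in>A. \<bar>S p\<bar> \<le> 1 / T"
        using small[OF e] by (auto simp: A_def abs_le_iff)
    qed (simp add: em)
    moreover have "c * (T * measure lborel A) = 4 * c * (T * e powr (k + l))"
      using em by (simp add: measure_def powr_add)
    moreover have "T * e powr (k + l) = K powr - (k + l) * T powr (1 - (k + l))"
      unfolding e_def using K(1) \<open>T > 0\<close> by (rule rescaled_powr)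
    ultimately show "4 * c * K powr - (k + l) * T powr (1 - (k + l)) \<le> \<Lambda> * I + B * T powr (1 - \<alpha>) / (1 - \<alpha>)"
      by (simp only: mult.assoc)
  qed (use c K in simp)
qed

text \<open>A point with x = e^m and x y \<le> e^\<kappa> lies in the box of weights m and \<kappa>
  - m. Letting m range over [k0, k1] fills a hyperbolic region of area (k1 - k0) e^\<kappa> ln
  (1/e).\<close>

lemma decay_ge_vertex:
  assumes k: "0 < k0" "k0 < k1" "k1 < \<kappa>"
      "\<And>k a b. \<lbrakk>k0 \<le> k; k \<le> k1; taylor_coeff S a b \<noteq> 0\<rbrakk> \<Longrightarrow> k * real a + (\<kappa> - k) * real b \<ge> 1"
  obtains I c T0 where "0 < c" "\<forall>T \<Lambda> \<alpha> B. T0 \<le> T \<longrightarrow> decays_on (osc_integral S \<phi>) \<Lambda> T \<alpha> B \<longrightarrow>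
      c * (ln T * T powr (1 - \<kappa>)) \<le> \<Lambda> * I + B * T powr (1 - \<alpha>) / (1 - \<alpha>)"
proof -
  obtain I c W where c: "0 < c" and W: "open W" "(0, 0) \<in> W"
    and bound: "\<And>A T \<Lambda> \<alpha> B. \<lbrakk>A \<in> sets lborel; emeasure lborel A < \<infinity>; A \<subseteq> W; \<forall>p\<in>A. \<bar>S p\<bar> \<le> 1 / T;
      decays_on (osc_integral S \<phi>) \<Lambda> T \<alpha> B\<rbrakk>
      \<Longrightarrow> c * (T * measure lborel A) \<le> \<Lambda> * I + B * T powr (1 - \<alpha>) / (1 - \<alpha>)"
    by (rule amplitude_sublevel_bound[OF S \<phi>]) blast
  \<comment> \<open>A common lower bound for all weights used, so that one \<open>K\<close> and one
    \<open>e0\<close> serve every box.\<close>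
  have \<sigma>: "min k0 (\<kappa> - k1) > 0" using k by simp
  obtain K e0 where K: "K > 0" "e0 > 0" and small: "\<forall>e k l x y. 0 < e \<longrightarrow> e \<le> e0 \<longrightarrow>
      min k0 (\<kappa> - k1) \<le> k \<longrightarrow> min k0 (\<kappa> - k1) \<le> l \<longrightarrow>
      (\<forall>a b. taylor_coeff S a b \<noteq> 0 \<longrightarrow> k * real a + l * real b \<ge> 1) \<longrightarrow>
      \<bar>x\<bar> \<le> e powr k \<longrightarrow> \<bar>y\<bar> \<le> e powr l \<longrightarrow> (x, y) \<in> W \<and> \<bar>S (x, y)\<bar> \<le> K * e"
    using small_on_weighted_box[OF S W \<sigma>] by blast
  show ?thesis
  \<comment> \<open>T \<ge> 1/(K e0) gives e \<le> e0, T \<ge> 2/K gives e \<le> 1/2, and T \<ge>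
    1/K^2 gives -ln e \<ge> (ln T)/2, the source of the factor 1/2.\<close>
  proof (rule that[of "c * K powr - \<kappa> * (k1 - k0) / 2" "max (max (1 / (K * e0)) (2 / K)) (max 1 (1 / K\<^sup>2))"]; (intro allI impI)?)
    fix T \<Lambda> \<alpha> B
    assume T0: "max (max (1 / (K * e0)) (2 / K)) (max 1 (1 / K\<^sup>2)) \<le> T"
      and decay: "decays_on (osc_integral S \<phi>) \<Lambda> T \<alpha> B"
    have T1: "1 / (K * e0) \<le> T" "2 / K \<le> T" "1 \<le> T" "1 / K\<^sup>2 \<le> T" using T0 by auto
    define e where "e = 1 / (K * T)"
    define A where "A = {(x, y). e powr k1 \<le> x \<and> x \<le> e powr k0 \<and> 0 \<le> y \<and> x * y \<le> e powr \<kappa>}"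
    have "T > 0" using decay by (simp add: decays_on_def)
    have e: "0 < e" "e \<le> e0" using K T1(1) \<open>T > 0\<close> by (auto simp: e_def field_simps)
    have e1: "e < 1" using K T1(2) \<open>T > 0\<close> by (simp add: e_def field_simps)
    have hyp: "e powr k1 \<le> e powr k0" using e(1) e1 k(2) by (simp add: powr_mono')
    have Am: "A \<in> sets lborel"
      unfolding A_def by (rule emeasure_lborel_hyperbolic(1)[OF _ hyp]) (use e(1) in simp_all)
    have "emeasure lborel A = ennreal (e powr \<kappa> * (ln (e powr k0) - ln (e powr k1)))"
      unfolding A_def by (rule emeasure_lborel_hyperbolic(2)[OF _ hyp]) (use e(1) in simp_all)
    moreover have "ln (e powr k0) - ln (e powr k1) = (k1 - k0) * - ln e"
      using e(1) by (simp add: ln_powr algebra_simps)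
    ultimately have em: "emeasure lborel A = ennreal (e powr \<kappa> * ((k1 - k0) * - ln e))" by simp
    have pos: "0 \<le> e powr \<kappa> * ((k1 - k0) * - ln e)"
      using k(2) e(1) e1 by (intro mult_nonneg_nonneg) auto
    have inA: "p \<in> W \<and> \<bar>S p\<bar> \<le> K * e" if "p \<in> A" for p
    proof -
      obtain x y where p: "p = (x, y)" by (cases p)
      have xy: "e powr k1 \<le> x" "x \<le> e powr k0" "0 \<le> y" "x * y \<le> e powr \<kappa>"
        using that by (auto simp: A_def p)
      have "0 < e powr k1" using e(1) by simp
      with xy(1) have "x > 0" by (rule less_le_trans[rotated])
      define m where "m = ln x / ln e"
      have "ln e < 0" using e(1) e1 by simp
      then have x: "x = e powr m" using \<open>x > 0\<close> e(1) by (simp add: m_def powr_def)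
      have "ln x \<le> ln (e powr k0)" "ln (e powr k1) \<le> ln x"
        using ln_mono[OF xy(2) \<open>x > 0\<close>] ln_mono[OF xy(1) \<open>0 < e powr k1\<close>] .
      then have m: "k0 \<le> m" "m \<le> k1" using \<open>ln e < 0\<close> e(1)
        by (simp_all add: m_def ln_powr neg_le_divide_eq neg_divide_le_eq)
      have "y \<le> e powr \<kappa> / x" using xy(4) \<open>x > 0\<close> by (simp add: field_simps)
      also have "\<dots> = e powr (\<kappa> - m)" by (simp add: x powr_diff)
      finally have "\<bar>y\<bar> \<le> e powr (\<kappa> - m)" using xy(3) by simp
      moreover have "\<bar>x\<bar> \<le> e powr m" using \<open>x > 0\<close> x by simp
      moreover have "min k0 (\<kappa> - k1) \<le> m" "min k0 (\<kappa> - k1) \<le> \<kappa> - m" using m by auto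
      ultimately show ?thesis unfolding p using small[rule_format, OF e, of m "\<kappa> - m" x y] k(4)[OF m] by blast
    qed
    have "c * (T * measure lborel A) \<le> \<Lambda> * I + B * T powr (1 - \<alpha>) / (1 - \<alpha>)"
    proof (rule bound[OF Am _ _ _ decay])
      show "A \<subseteq> W" using inA by blast
      have "K * e = 1 / T" using K \<open>T > 0\<close> by (simp add: e_def)
      then show "\<forall>p\<in>A. \<bar>S p\<bar> \<le> 1 / T" using inA by simp
    qed (simp add: em)
    moreover have "measure lborel A = e powr \<kappa> * ((k1 - k0) * - ln e)"
      using em pos by (simp add: measure_def)
    moreover have "T * e powr \<kappa> = K powr - \<kappa> * T powr (1 - \<kappa>)"
      unfolding e_def using K(1) \<open>T > 0\<close> by (rule rescaled_powr)
    ultimately have main: "c * (K powr - \<kappa> * T powr (1 - \<kappa>) * ((k1 - k0) * - ln e))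
        \<le> \<Lambda> * I + B * T powr (1 - \<alpha>) / (1 - \<alpha>)"
      by (simp add: mult.assoc[symmetric])
    have "ln T / 2 \<le> - ln e"
    proof -
      have "ln (1 / K\<^sup>2) \<le> ln T" using K T1(4) \<open>T > 0\<close> by (subst ln_le_cancel_iff) auto
      then have "- 2 * ln K \<le> ln T" using K by (simp add: ln_div ln_realpow)
      then show ?thesis using K \<open>T > 0\<close> by (simp add: e_def ln_div ln_mult)
    qed
    then have "c * (K powr - \<kappa> * T powr (1 - \<kappa>) * ((k1 - k0) * (ln T / 2)))
      \<le> c * (K powr - \<kappa> * T powr (1 - \<kappa>) * ((k1 - k0) * - ln e))"
      using c k(2) by (intro mult_left_mono) auto
    moreover have "c * K powr - \<kappa> * (k1 - k0) / 2 * (ln T * T powr (1 - \<kappa>))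
      = c * (K powr - \<kappa> * T powr (1 - \<kappa>) * ((k1 - k0) * (ln T / 2)))"
      by (simp add: mult_ac)
    ultimately show "c * K powr - \<kappa> * (k1 - k0) / 2 * (ln T * T powr (1 - \<kappa>))
        \<le> \<Lambda> * I + B * T powr (1 - \<alpha>) / (1 - \<alpha>)"
      using main by linarith
  qed (use c K k(2) in simp)
qed

end

section \<open>Contradiction with faster decay in the three cases\<close>

lemma eventually_le_bound_absurd:
  assumes "filterlim g at_top at_top" "0 < (c::real)" "eventually (\<lambda>T::real. c * g T \<le> C) at_top"
  shows False
proof -
  have "eventually (\<lambda>T. C / c < g T) at_top" using assms(1) by (simp add: filterlim_at_top_dense)
  with assms(3) have "eventually (\<lambda>T::real. False) at_top"
    by eventually_elim (use assms(2) in \<open>simp add: field_simps\<close>)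
  then show False by simp
qed

lemma Limsup_ratio_less:
  assumes "Limsup at_top (\<lambda>t. ereal (cmod (J t / complex_of_real (w t)))) < ereal B"
    and "eventually (\<lambda>t::real. 0 < w t) at_top"
  obtains \<Lambda> where "1 \<le> \<Lambda>" "\<And>t. \<Lambda> \<le> t \<Longrightarrow> cmod (J t) \<le> B * w t"
proof -
  from Limsup_lessD[OF assms(1)] assms(2) have "eventually (\<lambda>t. cmod (J t) \<le> B * w t) at_top"
    by eventually_elim (simp add: norm_divide field_simps)
  then obtain N where "\<And>t. N \<le> t \<Longrightarrow> cmod (J t) \<le> B * w t" by (auto simp: eventually_at_top_linorder)
  then show ?thesis by (intro that[of "max 1 N"]) auto
qed

theorem theorem1:
  fixes S :: "real \<times> real \<Rightarrow> real" and U :: "(real \<times> real) set" and d :: real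
  assumes "open U" and "(0, 0) \<in> U" and "smooth_on S U"
    and "S (0, 0) = 0" and "(S has_derivative (\<lambda>_. 0)) (at (0, 0))"
    and "\<exists>a b. taylor_coeff S a b \<noteq> 0"
    and "superadapted S" and "d = newton_distance S" and "d > 1"
  shows "\<exists>V. open V \<and> (0, 0) \<in> V \<and> V \<subseteq> U \<and>
    (\<forall>\<phi> :: real \<times> real \<Rightarrow> real.
       smooth_on \<phi> UNIV \<and> compact (closure {p. \<phi> p \<noteq> 0}) \<and> closure {p. \<phi> p \<noteq> 0} \<subseteq> V \<and>
       (\<forall>p. \<phi> p \<ge> 0) \<and> \<phi> (0, 0) > 0 \<longrightarrow>
       (bisectrix_in_compact_edge S \<longrightarrow>
          Limsup at_top (\<lambda>lam. ereal (cmod (osc_integral S \<phi> lam /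
            complex_of_real (lam powr (- 1 / d))))) > 0) \<and>
       (bisectrix_at_vertex S \<longrightarrow>
          Limsup at_top (\<lambda>lam. ereal (cmod (osc_integral S \<phi> lam /
            complex_of_real (lam powr (- 1 / d) * ln lam)))) > 0) \<and>
       (bisectrix_in_unbounded_ray S \<longrightarrow>
          (\<forall>\<delta>>0. Limsup at_top (\<lambda>lam. ereal (cmod (osc_integral S \<phi> lam /
            complex_of_real (lam powr (- 1 / d - \<delta>))))) = \<infinity>)))"
\<comment> \<open>U itself serves as V: by nonnegativity of \<phi> and of the Fejer kernel, the part
  of the integral near the origin bounds the whole from below.\<close>
proof (rule exI[of _ U], intro conjI assms(1,2) subset_refl allI impI)
  fix \<phi> :: "real \<times> real \<Rightarrow> real" and \<delta> :: real
  assume \<phi>: "smooth_on \<phi> UNIV \<and> compact (closure {p. \<phi> p \<noteq> 0}) \<and> closure {p. \<phi> p \<noteq> 0} \<subseteq> U \<and>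
       (\<forall>p. \<phi> p \<ge> 0) \<and> \<phi> (0, 0) > 0"
  interpret oscillatory_data S \<phi> U by unfold_locales (use assms \<phi> in auto)
  define s where "s = 1 - 1 / d"
  have s: "0 < s" using \<open>d > 1\<close> by (simp add: s_def)
  have "d > 0" using \<open>d > 1\<close> by simp
  obtain k l where kl: "0 \<le> k" "0 \<le> l" "(k + l) * d = 1"
    "\<And>a b. taylor_coeff S a b \<noteq> 0 \<Longrightarrow> k * real a + l * real b \<ge> 1"
    using newton_polygon_supporting_line[OF assms(6) \<open>d = newton_distance S\<close> \<open>d > 0\<close>] by blast
  have kl_sum: "k + l = 1 / d" using kl(3) \<open>d > 0\<close> by (simp add: field_simps)
  have powr_top: "filterlim (\<lambda>T. T powr q) at_top at_top" if "0 < q" for q :: real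
  proof -
    have "filterlim (\<lambda>T. exp (q * ln T)) at_top at_top"
      by (intro filterlim_compose[OF exp_at_top] filterlim_tendsto_pos_mult_at_top[OF tendsto_const that] ln_at_top)
    moreover have "eventually (\<lambda>T. exp (q * ln T) = T powr q) at_top"
      using eventually_gt_at_top[of 0] by eventually_elim (simp add: powr_def)
    ultimately show ?thesis by (rule filterlim_mono_eventually[OF _ order_refl order_refl])
  qed
  show "Limsup at_top (\<lambda>lam. ereal (cmod (osc_integral S \<phi> lam / complex_of_real (lam powr (- 1 / d))))) > 0"
    if edge: "bisectrix_in_compact_edge S"
  proof (rule ccontr)
    assume "\<not> ?thesis"
    then have lim: "Limsup at_top (\<lambda>lam. ereal (cmod (osc_integral S \<phi> lam / complex_of_real (lam powr (- 1 / d))))) \<le> 0"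
      by simp
    obtain e where "e edge_of newton_polygon S" "compact e" "(d, d) \<in> rel_interior e"
      using edge \<open>d = newton_distance S\<close> by (auto simp: bisectrix_in_compact_edge_def)
    then have pos: "0 < k" "0 < l" using compact_edge_weights_pos kl by blast+
    obtain I c T0 where c: "0 < c" and bound: "\<forall>T \<Lambda> \<alpha> B. T0 \<le> T \<longrightarrow> decays_on (osc_integral S \<phi>) \<Lambda> T \<alpha> B \<longrightarrow>
      c * T powr (1 - (k + l)) \<le> \<Lambda> * I + B * T powr (1 - \<alpha>) / (1 - \<alpha>)"
      by (rule decay_ge_box[OF pos kl(4)]) blast
    \<comment> \<open>Then the decay term B T^s / s is half of the lower bound c T^s. Absorbing it
      leaves a multiple of T^s bounded by a constant.\<close>
    define B where "B = c * s / 2"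
    have "B > 0" using c s by (simp add: B_def)
    obtain \<Lambda> where \<Lambda>: "1 \<le> \<Lambda>" "\<And>t. \<Lambda> \<le> t \<Longrightarrow> cmod (osc_integral S \<phi> t) \<le> B * t powr (- 1 / d)"
    proof (rule Limsup_ratio_less)
      show "Limsup at_top (\<lambda>t. ereal (cmod (osc_integral S \<phi> t / complex_of_real (t powr (- 1 / d))))) < ereal B"
        using lim \<open>B > 0\<close> by (simp add: le_less_trans)
      show "eventually (\<lambda>t::real. 0 < t powr (- 1 / d)) at_top"
        using eventually_gt_at_top[of 0] by eventually_elim simp
    qed blast
    have ev: "eventually (\<lambda>T. c / 2 * T powr s \<le> \<Lambda> * I) at_top"
      using eventually_ge_at_top[of T0] eventually_ge_at_top[of \<Lambda>]
    proof eventually_elim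
      case (elim T)
      have "c * T powr (1 - (k + l)) \<le> \<Lambda> * I + B * T powr (1 - 1 / d) / (1 - 1 / d)"
        using elim \<Lambda> \<open>B > 0\<close> \<open>d > 1\<close> by (intro bound[rule_format]) (auto simp: decays_on_def)
      then have "c * T powr s \<le> \<Lambda> * I + B * T powr s / s" by (simp add: kl_sum s_def)
      also have "B * T powr s / s = c / 2 * T powr s" using s by (simp add: B_def)
      finally show ?case by simp
    qed
    show False by (rule eventually_le_bound_absurd[OF powr_top[OF s] _ ev]) (use c in simp)
  qed
  show "Limsup at_top (\<lambda>lam. ereal (cmod (osc_integral S \<phi> lam / complex_of_real (lam powr (- 1 / d) * ln lam)))) > 0"
    if vertex: "bisectrix_at_vertex S"
  proof (rule ccontr)
    assume "\<not> ?thesis"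
    then have lim: "Limsup at_top (\<lambda>lam. ereal (cmod (osc_integral S \<phi> lam / complex_of_real (lam powr (- 1 / d) * ln lam)))) \<le> 0"
      by simp
    obtain k0 k1 where k: "0 < k0" "k0 < k1" "k1 < 1 / d"
      "\<And>k a b. \<lbrakk>k0 \<le> k; k \<le> k1; taylor_coeff S a b \<noteq> 0\<rbrakk> \<Longrightarrow> k * real a + (1 / d - k) * real b \<ge> 1"
      by (rule vertex_weights[OF vertex \<open>d = newton_distance S\<close> \<open>d > 0\<close>]) blast
    obtain I c T0 where c: "0 < c" and bound: "\<forall>T \<Lambda> \<alpha> B. T0 \<le> T \<longrightarrow> decays_on (osc_integral S \<phi>) \<Lambda> T \<alpha> B \<longrightarrow>
      c * (ln T * T powr (1 - 1 / d)) \<le> \<Lambda> * I + B * T powr (1 - \<alpha>) / (1 - \<alpha>)"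
      by (rule decay_ge_vertex[OF k]) blast
    define B where "B = c * s / 2"
    have "B > 0" using c s by (simp add: B_def)
    obtain \<Lambda> where \<Lambda>: "1 \<le> \<Lambda>" "\<And>t. \<Lambda> \<le> t \<Longrightarrow> cmod (osc_integral S \<phi> t) \<le> B * (t powr (- 1 / d) * ln t)"
    proof (rule Limsup_ratio_less)
      show "Limsup at_top (\<lambda>t. ereal (cmod (osc_integral S \<phi> t / complex_of_real (t powr (- 1 / d) * ln t)))) < ereal B"
        using lim \<open>B > 0\<close> by (simp add: le_less_trans)
      show "eventually (\<lambda>t::real. 0 < t powr (- 1 / d) * ln t) at_top"
        using eventually_gt_at_top[of 1] by eventually_elim simp
    qed blast
    have ev: "eventually (\<lambda>T. c / 2 * (ln T * T powr s) \<le> \<Lambda> * I) at_top"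
      using eventually_ge_at_top[of T0] eventually_ge_at_top[of \<Lambda>]
    proof eventually_elim
      case (elim T)
      have lnT: "0 \<le> ln T" using elim \<Lambda>(1) by simp
      \<comment> \<open>On [\<Lambda>, T] the logarithm is at most ln T, so pure power decay holds
        with constant B ln T.\<close>
      have "cmod (osc_integral S \<phi> t) \<le> B * ln T * t powr (- (1 / d))" if "\<Lambda> \<le> t" "t \<le> T" for t
      proof -
        have "ln t \<le> ln T" using that \<Lambda>(1) by simp
        then have "B * (t powr (- 1 / d) * ln t) \<le> B * (t powr (- 1 / d) * ln T)"
          using \<open>B > 0\<close> by (intro mult_left_mono) auto
        then show ?thesis using \<Lambda>(2)[OF that(1)] by (simp add: mult_ac)
      qed
      then have "c * (ln T * T powr (1 - 1 / d)) \<le> \<Lambda> * I + B * ln T * T powr (1 - 1 / d) / (1 - 1 / d)"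
        using elim \<Lambda>(1) lnT \<open>B > 0\<close> \<open>d > 1\<close> by (intro bound[rule_format]) (auto simp: decays_on_def)
      then have "c * (ln T * T powr s) \<le> \<Lambda> * I + B * ln T * T powr s / s" by (simp add: s_def)
      also have "B * ln T * T powr s / s = c / 2 * (ln T * T powr s)" using s by (simp add: B_def)
      finally show ?case by simp
    qed
    have "filterlim (\<lambda>T. ln T * T powr s) at_top at_top"
      by (intro filterlim_at_top_mult_at_top ln_at_top powr_top s)
    then show False by (rule eventually_le_bound_absurd[OF _ _ ev]) (use c in simp)
  qed
  show "Limsup at_top (\<lambda>lam. ereal (cmod (osc_integral S \<phi> lam / complex_of_real (lam powr (- 1 / d - \<delta>))))) = \<infinity>"
    if "bisectrix_in_unbounded_ray S" and \<delta>: "\<delta> > 0"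
  proof (rule ccontr)
    assume "\<not> ?thesis"
    then obtain B where B: "Limsup at_top (\<lambda>lam. ereal (cmod (osc_integral S \<phi> lam / complex_of_real (lam powr (- 1 / d - \<delta>))))) < ereal B"
      using less_PInf_Ex_of_nat by fastforce
    \<comment> \<open>Raising both weights by h makes them positive and costs T^(2h). Since 4 h
      \<le> \<delta>, the assumed decay includes the exponent 1/d + 4 h, so a net gain T^(2h)
      remains; 4 h < s keeps this exponent below 1.\<close>
    define h where "h = min \<delta> (s / 2) / 4"
    have h: "0 < h" "4 * h \<le> \<delta>" "4 * h < s" using \<delta> s by (auto simp: h_def)
    have pos: "0 < k + h" "0 < l + h" using kl h by auto
    have supp: "(k + h) * real a + (l + h) * real b \<ge> 1" if "taylor_coeff S a b \<noteq> 0" for a b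
      proof -
      have "0 \<le> h * real a" "0 \<le> h * real b" using h(1) by auto
      then show ?thesis using kl(4)[OF that] unfolding distrib_right by linarith
    qed
    obtain I c T0 where c: "0 < c" and bound: "\<forall>T \<Lambda> \<alpha> B. T0 \<le> T \<longrightarrow> decays_on (osc_integral S \<phi>) \<Lambda> T \<alpha> B \<longrightarrow>
      c * T powr (1 - ((k + h) + (l + h))) \<le> \<Lambda> * I + B * T powr (1 - \<alpha>) / (1 - \<alpha>)"
      by (rule decay_ge_box[OF pos supp]) blast
    obtain \<Lambda> where \<Lambda>: "1 \<le> \<Lambda>" "\<And>t. \<Lambda> \<le> t \<Longrightarrow> cmod (osc_integral S \<phi> t) \<le> B * t powr (- 1 / d - \<delta>)"
    proof (rule Limsup_ratio_less[OF B])
      show "eventually (\<lambda>t::real. 0 < t powr (- 1 / d - \<delta>)) at_top"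
        using eventually_gt_at_top[of 0] by eventually_elim simp
    qed blast
    define M where "M = \<bar>B\<bar> / (s - 4 * h)"
    \<comment> \<open>From here on c T^(2h) \<ge> M + 1: the term with \<open>M\<close> is absorbed
      and one copy of T^(s - 4h) is left over, bounded by \<Lambda> I.\<close>
    have "eventually (\<lambda>T. (M + 1) / c \<le> T powr (2 * h)) at_top"
      using powr_top[of "2 * h"] h(1) by (simp add: filterlim_at_top)
    then have ev: "eventually (\<lambda>T. 1 * T powr (s - 4 * h) \<le> \<Lambda> * I) at_top"
      using eventually_ge_at_top[of T0] eventually_ge_at_top[of \<Lambda>]
    proof eventually_elim
      case (elim T)
      have "cmod (osc_integral S \<phi> t) \<le> \<bar>B\<bar> * t powr (- (1 / d + 4 * h))" if "\<Lambda> \<le> t" "t \<le> T" for t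
      proof -
        have "B * t powr (- 1 / d - \<delta>) \<le> \<bar>B\<bar> * t powr (- (1 / d + 4 * h))"
          using that \<Lambda>(1) h(2) by (intro mult_mono powr_mono) auto
        then show ?thesis using \<Lambda>(2)[OF that(1)] by linarith
      qed
      then have "c * T powr (1 - ((k + h) + (l + h)))
          \<le> \<Lambda> * I + \<bar>B\<bar> * T powr (1 - (1 / d + 4 * h)) / (1 - (1 / d + 4 * h))"
        using elim \<Lambda>(1) h(3) by (intro bound[rule_format]) (auto simp: s_def decays_on_def)
      moreover have "1 - ((k + h) + (l + h)) = (s - 4 * h) + 2 * h" "1 - (1 / d + 4 * h) = s - 4 * h"
        using kl_sum by (auto simp: s_def)
      ultimately have "c * (T powr (s - 4 * h) * T powr (2 * h)) \<le> \<Lambda> * I + M * T powr (s - 4 * h)"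
        by (simp only: powr_add M_def times_divide_eq_left)
      moreover have "T powr (s - 4 * h) * (M + 1) \<le> T powr (s - 4 * h) * (c * T powr (2 * h))"
        using elim(1) c by (intro mult_left_mono) (auto simp: pos_divide_le_eq mult.commute)
      ultimately show ?case by (simp add: algebra_simps)
    qed
    show False by (rule eventually_le_bound_absurd[OF powr_top _ ev]) (use h in auto)
  qed
qed

end
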